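(* Let $\Gamma\subset SU(3)$ be a finite subgroup and consider the $\mathbb C^3/\Gamma$ orbifold of $\mathcal N=4$ super-Yang--Mills. In the large-$N$ limit, its Hagedorn point $x_{\rm Hag}=e^{-1/T_{\rm Hag}}\in(0,1)$ is determined by $$1-z_{\rm v}(x,1)=\lambda^{\mathcal N=1}_{\max}\,z_{\rm c}(x,1),\qquad \lambda^{\mathcal N=1}_{\max}=3.$$ Consequently all these theories have the same Hagedorn temperature as the $\mathcal N=2$ affine quivers, whose Hagedorn point is determined by $1-z_{\rm V}(x,1)=2\,z_{\rm H}(x,1)$.
   Context: **Single-letter functions.** $z_\phi(x)=\frac{x(1+x)}{(1-x)^3}$, $z_\psi(x)=\frac{4x^{3/2}}{(1-x)^3}$, $z_A(x)=\frac{6x^2-2x^3}{(1-x)^3}$. For $n\ge1$ the $\mathcal N=1$ vector and chiral functions are $z_{\rm v}(x,n)=z_A(x^n)+(-1)^{n+1}z_\psi(x^n)$ and $z_{\rm c}(x,n)=2z_\phi(x^n)+(-1)^{n+1}z_\psi(x^n)$. The $\mathcal N=2$ vector and half-hypermultiplet functions are $z_{\rm V}(x,n)=z_A(x^n)+2z_\phi(x^n)+(-1)^{n+1}2z_\psi(x^n)$ and $z_{\rm H}(x,n)=2z_\phi(x^n)+(-1)^{n+1}z_\psi(x^n)$. **Orbifold quiver.** Let $\chi_i$ be the irreducible characters of $\Gamma$ and $\chi_{\mathbf 3}$ the character of the restriction to $\Gamma$ of the defining representation of $SU(3)$. The adjacency matrix $A$ (not necessarily symmetric) has non-negative integer entries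 defined by $\chi_{\mathbf 3}(g)\chi_i(g)=\sum_jA^{ij}\chi_j(g)$. The quiver has one special-unitary gauge node per irreducible representation, of rank growing with $N$, and $A^{ij}$ chiral multiplets in the bifundamental representation of nodes $i,j$. **Large-$N$ partition function and Hagedorn point.** In the overall-free and large-$N$ limit the thermal partition function ($x=e^{-1/T}$, $T$ the temperature) is, up to source-free constant factors, the product over $n\ge1$ of complex Gaussian integrals over variables $p_n=(p^{(i)}_n)_i$ (one per node) with weight $$\exp\Big[-\tfrac1n\,\overline p_n\cdot\Big(\big(1-z_{\rm v}(x,n)\big)\mathbf 1-z_{\rm c}(x,n)\tfrac{A+A^T}{2}\Big)\cdot p_n\Big].$$ (The symmetrisation accounts for chiral multiplets together with their CPT conjugates.) The Hagedorn point $x_{\rm Hag}$ is the smallest $x\in(0,1)$ at which one of these Gaussian integrals ceases to converge, i.e. the matrix in the exponent ceases to be positive definite for some $n$; it is the first singularity of the partition function. *)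

theory Defs
  imports
    Complex_Main
    "HOL-Algebra.Group"
    "Jordan_Normal_Form.Matrix"
    "Jordan_Normal_Form.Determinant"
    "Jordan_Normal_Form.Char_Poly"
    "Jordan_Normal_Form.Schur_Decomposition"
    "Jordan_Normal_Form.VS_Connect"
begin

section \<open>Finite subgroups of SU(3), representations and characters\<close>

definition mat_trace :: "'a::comm_monoid_add mat \<Rightarrow> 'a" where
  "mat_trace M = (\<Sum>i<dim_row M. M $$ (i, i))"

definition SU3 :: "complex mat monoid" where
  "SU3 = \<lparr>carrier = {U \<in> carrier_mat 3 3. U * mat_adjoint U = 1\<^sub>m 3 \<and> det U = 1},
          monoid.mult = (*), one = 1\<^sub>m 3\<rparr>"

definition GL :: "nat \<Rightarrow> complex mat monoid" where
  "GL n = units_of (ring_mat TYPE(complex) n ())"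

text \<open>Complex representations of dimension \<open>n\<close>, in matrix form.\<close>

definition representation :: "('g, 'b) monoid_scheme \<Rightarrow> nat \<Rightarrow> ('g \<Rightarrow> complex mat) \<Rightarrow> bool" where
  "representation G n \<rho> \<longleftrightarrow> \<rho> \<in> hom G (GL n)"

definition irreducible_representation ::
  "('g, 'b) monoid_scheme \<Rightarrow> nat \<Rightarrow> ('g \<Rightarrow> complex mat) \<Rightarrow> bool" where
  "irreducible_representation G n \<rho> \<longleftrightarrow>
     representation G n \<rho> \<and> n \<ge> 1 \<and>
     (\<forall>W. VectorSpace.subspace class_ring W (module_vec TYPE(complex) n) \<and>
          (\<forall>g\<in>carrier G. \<forall>w\<in>W. \<rho> g *\<^sub>v w \<in> W)
        \<longrightarrow> W = {0\<^sub>v n} \<or> W = carrier_vec n)"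

text \<open>Characters are made extensional (restricted to the carrier), so that characters which
  agree on \<open>G\<close> are equal as HOL functions.\<close>

definition irreducible_characters :: "('g, 'b) monoid_scheme \<Rightarrow> ('g \<Rightarrow> complex) set" where
  "irreducible_characters G =
     {restrict (\<lambda>g. mat_trace (\<rho> g)) (carrier G) | n \<rho>. irreducible_representation G n \<rho>}"

text \<open>The nodes of the quiver are \<open>0, \<dots>, r - 1\<close>, node \<open>i\<close> carrying the irreducible character
  \<open>\<chi> i\<close>. The character of the restricted defining representation is \<open>g \<mapsto> tr g\<close>.\<close>

definition quiver_adjacency ::
  "complex mat set \<Rightarrow> nat \<Rightarrow> (nat \<Rightarrow> complex mat \<Rightarrow> complex) \<Rightarrow> nat mat \<Rightarrow> bool" where
  "quiver_adjacency \<Gamma> r \<chi> A \<longleftrightarrow>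
     A \<in> carrier_mat r r \<and>
     (\<forall>g\<in>\<Gamma>. \<forall>i<r. mat_trace g * \<chi> i g = (\<Sum>j<r. of_nat (A $$ (i, j)) * \<chi> j g))"


section \<open>Single-letter functions\<close>

definition z_phi :: "real \<Rightarrow> real" where
  "z_phi x = x * (1 + x) / (1 - x) ^ 3"

definition z_psi :: "real \<Rightarrow> real" where
  "z_psi x = 4 * x powr (3 / 2) / (1 - x) ^ 3"

definition z_A :: "real \<Rightarrow> real" where
  "z_A x = (6 * x ^ 2 - 2 * x ^ 3) / (1 - x) ^ 3"

definition z_v :: "real \<Rightarrow> nat \<Rightarrow> real" where
  "z_v x n = z_A (x ^ n) + (-1) ^ (n + 1) * z_psi (x ^ n)"

definition z_c :: "real \<Rightarrow> nat \<Rightarrow> real" where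
  "z_c x n = 2 * z_phi (x ^ n) + (-1) ^ (n + 1) * z_psi (x ^ n)"

definition z_V :: "real \<Rightarrow> nat \<Rightarrow> real" where
  "z_V x n = z_A (x ^ n) + 2 * z_phi (x ^ n) + (-1) ^ (n + 1) * (2 * z_psi (x ^ n))"

definition z_H :: "real \<Rightarrow> nat \<Rightarrow> real" where
  "z_H x n = 2 * z_phi (x ^ n) + (-1) ^ (n + 1) * z_psi (x ^ n)"


section \<open>Gaussian weights and the Hagedorn point\<close>

definition symmetrised :: "nat mat \<Rightarrow> real mat" where
  "symmetrised A = (1 / 2) \<cdot>\<^sub>m (map_mat real A + transpose_mat (map_mat real A))"

definition lambda_max :: "real mat \<Rightarrow> real" where
  "lambda_max M = Max {k. eigenvalue M k}"

definition positive_definite :: "complex mat \<Rightarrow> bool" where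
  "positive_definite M \<longleftrightarrow>
     mat_adjoint M = M \<and>
     (\<forall>p\<in>carrier_vec (dim_row M). p \<noteq> 0\<^sub>v (dim_row M) \<longrightarrow> 0 < Re (conjugate p \<bullet> (M *\<^sub>v p)))"

text \<open>The Gaussian weight of the \<open>n\<close>-th factor of the partition function is
  \<open>exp (- conjugate p \<bullet> (K *\<^sub>v p))\<close>, with \<open>K\<close> the following matrix.\<close>

definition N1_weight :: "nat mat \<Rightarrow> real \<Rightarrow> nat \<Rightarrow> complex mat" where
  "N1_weight A x n = map_mat complex_of_real
     ((1 / real n) \<cdot>\<^sub>m ((1 - z_v x n) \<cdot>\<^sub>m 1\<^sub>m (dim_row A) - z_c x n \<cdot>\<^sub>m symmetrised A))"

text \<open>For an \<open>\<N> = 2\<close> quiver whose edges are hypermultiplets, \<open>B\<close> is the (symmetric) adjacency matrix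
  of the underlying graph; each edge contributes one half-hypermultiplet letter function in either
  direction. In \<open>\<N> = 1\<close> language the adjacency matrix is \<open>1 + B\<close> (an adjoint chiral multiplet at
  each node, two opposite chiral multiplets per edge), and
  \<open>z_V = z_v + z_c\<close>, \<open>z_H = z_c\<close> turn the \<open>\<N> = 1\<close> weight into this one.\<close>

definition N2_weight :: "nat mat \<Rightarrow> real \<Rightarrow> nat \<Rightarrow> complex mat" where
  "N2_weight B x n = map_mat complex_of_real
     ((1 / real n) \<cdot>\<^sub>m ((1 - z_V x n) \<cdot>\<^sub>m 1\<^sub>m (dim_row B) - z_H x n \<cdot>\<^sub>m map_mat real B))"

definition divergence_points :: "(real \<Rightarrow> nat \<Rightarrow> complex mat) \<Rightarrow> real set" where
  "divergence_points K = {x. 0 < x \<and> x < 1 \<and> (\<exists>n\<ge>1. \<not> positive_definite (K x n))}"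

definition is_Hagedorn_point :: "(real \<Rightarrow> nat \<Rightarrow> complex mat) \<Rightarrow> real \<Rightarrow> bool" where
  "is_Hagedorn_point K x \<longleftrightarrow>
     x \<in> divergence_points K \<and> (\<forall>y\<in>divergence_points K. x \<le> y)"

definition is_Hagedorn_temperature :: "(real \<Rightarrow> nat \<Rightarrow> complex mat) \<Rightarrow> real \<Rightarrow> bool" where
  "is_Hagedorn_temperature K T \<longleftrightarrow> T > 0 \<and> is_Hagedorn_point K (exp (- 1 / T))"


section \<open>Affine quivers\<close>

definition graph_adjacency :: "nat \<Rightarrow> (nat \<times> nat) set \<Rightarrow> nat mat" where
  "graph_adjacency m E = mat m m (\<lambda>(i, j). if (i, j) \<in> E \<or> (j, i) \<in> E then 1 else 0)"

text \<open>Adjacency matrices of the affine (extended) Dynkin diagrams of types A, D, E. In type A the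
  diagram is the cycle with \<open>k\<close> nodes; the formula gives a double edge for \<open>k = 2\<close> and, for \<open>k = 1\<close>,
  a single node with one loop, counted twice (one adjoint hypermultiplet, i.e. \<open>\<N> = 4\<close>
  super-Yang--Mills). The diagram of affine \<open>D_k\<close> has \<open>k + 1\<close> nodes.\<close>

inductive affine_ADE :: "nat mat \<Rightarrow> bool" where
  affine_A: "k \<ge> 1 \<Longrightarrow> affine_ADE (mat k k (\<lambda>(i, j).
     (if j = (i + 1) mod k then 1 else 0) + (if i = (j + 1) mod k then 1 else 0)))"
| affine_D: "k \<ge> 4 \<Longrightarrow> affine_ADE (graph_adjacency (k + 1)
     ({(0, 2), (1, 2), (k - 2, k - 1), (k - 2, k)} \<union> {(i, i + 1) | i. 2 \<le> i \<and> i < k - 2}))"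
| affine_E6: "affine_ADE (graph_adjacency 7 {(0,1), (1,2), (0,3), (3,4), (0,5), (5,6)})"
| affine_E7: "affine_ADE (graph_adjacency 8 {(0,1), (1,2), (2,3), (0,4), (4,5), (5,6), (0,7)})"
| affine_E8: "affine_ADE (graph_adjacency 9
     {(0,1), (1,2), (2,3), (3,4), (4,5), (0,6), (6,7), (0,8)})"

end

theory Submission
  imports Defs "Jordan_Normal_Form.Spectral_Radius" "HOL-Algebra.Multiplicative_Group"
begin

text \<open>For a real vector \<open>p\<close> put \<open>f = (\<Sum>i. p\<^sub>i \<chi>\<^sub>i)\<close>. Orthonormality of the irreducible characters gives
  \<open>(\<Sum>i. \<Sum>j. A\<^sub>i\<^sub>j p\<^sub>i p\<^sub>j) = (\<Sum>g\<in>\<Gamma>. tr g * \<bar>f g\<bar>\<^sup>2) / \<bar>\<Gamma>\<bar>\<close> and \<open>(\<Sum>i. p\<^sub>i\<^sup>2) = (\<Sum>g\<in>\<Gamma>. \<bar>f g\<bar>\<^sup>2) / \<bar>\<Gamma>\<bar>\<close>.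
  As \<open>\<bar>tr g\<bar> \<le> 3\<close>, the Rayleigh quotient of the symmetrised adjacency matrix is at most 3, and the
  vector of the dimensions \<open>\<chi>\<^sub>i(1)\<close> attains this bound.

  Since \<open>z_c \<ge> 0\<close>, the \<open>n\<close>-th Gaussian integral converges iff \<open>3 z_c < 1 - z_v\<close>. In terms of
  \<open>s = x\<^sup>n\<^sup>/\<^sup>2\<close> the sign of \<open>1 - z_v - 3 z_c\<close> is that of \<open>1 - 4 s + s\<^sup>2\<close> for odd \<open>n\<close>, and it is positive for even \<open>n\<close>;
  so the first divergence occurs for \<open>n = 1\<close> at \<open>s = 2 - \<surd>3\<close>. The affine quivers lead to the same
  condition, because their adjacency matrices have a positive eigenvector (the marks of the
  diagram) with eigenvalue 2 and \<open>z_V = z_v + z_c\<close>, \<open>z_H = z_c\<close>.\<close>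

section \<open>Quadratic forms and Rayleigh quotients\<close>

text \<open>A symmetric matrix together with the attained maximum of its Rayleigh quotient. Both
  consumers need just this: positive definiteness of the weights uses the bound and the maximiser
  directly, and \<open>lambda_max\<close> is recovered from them.\<close>

definition max_rayleigh :: "nat \<Rightarrow> real mat \<Rightarrow> real \<Rightarrow> bool" where
  "max_rayleigh n S l \<longleftrightarrow> S \<in> carrier_mat n n \<and> transpose_mat S = S \<and>
     (\<forall>p\<in>carrier_vec n. p \<bullet> (S *\<^sub>v p) \<le> l * (p \<bullet> p)) \<and>
     (\<exists>p\<in>carrier_vec n. p \<noteq> 0\<^sub>v n \<and> p \<bullet> (S *\<^sub>v p) = l * (p \<bullet> p))"

lemma scalar_prod_self_pos:
  fixes p :: "real vec"
  assumes "p \<in> carrier_vec n" "p \<noteq> 0\<^sub>v n"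
  shows "0 < p \<bullet> p"
  using conjugate_square_greater_0_vec[of p n] assms by simp

text \<open>A maximiser of the Rayleigh quotient is a critical point, and the critical-point
  equation is the eigenvector equation. The test direction is the defect \<open>w\<close>
  itself.\<close>

lemma max_rayleigh_eigenvector:
  assumes M: "max_rayleigh n S l"
    and d: "d \<in> carrier_vec n" and eq: "d \<bullet> (S *\<^sub>v d) = l * (d \<bullet> d)"
  shows "S *\<^sub>v d = l \<cdot>\<^sub>v d"
proof -
  have S: "S \<in> carrier_mat n n" and sym: "transpose_mat S = S"
    and le: "\<And>p. p \<in> carrier_vec n \<Longrightarrow> p \<bullet> (S *\<^sub>v p) \<le> l * (p \<bullet> p)"
    using M unfolding max_rayleigh_def by auto
  define w where "w = l \<cdot>\<^sub>v d - S *\<^sub>v d"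
  have w: "w \<in> carrier_vec n" and Sd: "S *\<^sub>v d \<in> carrier_vec n" and Sw: "S *\<^sub>v w \<in> carrier_vec n"
    using S d unfolding w_def by auto
  have swap: "d \<bullet> (S *\<^sub>v w) = w \<bullet> (S *\<^sub>v d)"
    using transpose_vec_mult_scalar[OF S w d] sym comm_scalar_prod[OF Sd w] comm_scalar_prod[OF Sw d]
    by (metis sym)
  have ww: "w \<bullet> w = l * (w \<bullet> d) - w \<bullet> (S *\<^sub>v d)"
    using d Sd w by (subst (2) w_def) (simp add: scalar_prod_minus_distrib[of w n])
  define q where "q = l * (w \<bullet> w) - w \<bullet> (S *\<^sub>v w)"
  \<comment> \<open>\<open>d\<close> minimises the nonnegative form \<open>l * (u \<bullet> u) - u \<bullet> (S *\<^sub>v u)\<close>, so its derivative at \<open>d\<close>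
    in the direction \<open>w\<close>, which is \<open>2 * (w \<bullet> w)\<close>, vanishes.\<close>
  have key: "0 \<le> 2 * t * (w \<bullet> w) + t\<^sup>2 * q" for t
  proof -
    define u where "u = d + t \<cdot>\<^sub>v w"
    have u: "u \<in> carrier_vec n" using d w by (simp add: u_def)
    have Su: "S *\<^sub>v u = S *\<^sub>v d + t \<cdot>\<^sub>v (S *\<^sub>v w)"
      using S d w unfolding u_def by (simp add: mult_add_distrib_mat_vec[of _ n n] mult_mat_vec[of _ n n])
    have 1: "u \<bullet> (S *\<^sub>v u) = d \<bullet> (S *\<^sub>v d) + 2 * t * (w \<bullet> (S *\<^sub>v d)) + t\<^sup>2 * (w \<bullet> (S *\<^sub>v w))"
      unfolding Su using d w Sd Sw unfolding u_def
      by (simp add: scalar_prod_add_distrib[of _ n] add_scalar_prod_distrib[of _ n] swap power2_eq_square algebra_simps)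
    have 2: "u \<bullet> u = d \<bullet> d + 2 * t * (w \<bullet> d) + t\<^sup>2 * (w \<bullet> w)"
      using d w unfolding u_def
      by (simp add: scalar_prod_add_distrib[of _ n] add_scalar_prod_distrib[of _ n] comm_scalar_prod[of d n w]
          power2_eq_square algebra_simps)
    have "0 \<le> l * (u \<bullet> u) - u \<bullet> (S *\<^sub>v u)" using le[OF u] by simp
    also have "\<dots> = 2 * t * (w \<bullet> w) + t\<^sup>2 * q"
      unfolding 1 2 ww eq q_def by (simp add: algebra_simps)
    finally show ?thesis .
  qed
  have "w \<bullet> w = 0"
  proof (rule ccontr)
    assume "w \<bullet> w \<noteq> 0"
    then have "w \<noteq> 0\<^sub>v n" using w by auto
    then have pos: "0 < w \<bullet> w" using scalar_prod_self_pos[OF w] by simp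
    \<comment> \<open>A small negative step: dividing by \<open>\<bar>q\<bar> + 1\<close>, which is
      positive even for q = 0, gives \<bar>t q\<bar> \<le> w \<bullet> w, so the linear term decides
      the sign.\<close>
    define t where "t = - (w \<bullet> w) / (\<bar>q\<bar> + 1)"
    have t: "t < 0" unfolding t_def using pos by (simp add: divide_neg_pos)
    have "2 * t * (w \<bullet> w) + t\<^sup>2 * q = t * (2 * (w \<bullet> w) + t * q)" by (simp add: power2_eq_square algebra_simps)
    moreover have "\<bar>t * q\<bar> \<le> w \<bullet> w"
      unfolding t_def using pos by (simp add: abs_mult field_simps)
    then have "2 * (w \<bullet> w) + t * q > 0" using pos by linarith
    ultimately have "2 * t * (w \<bullet> w) + t\<^sup>2 * q < 0" using t by (simp add: mult_neg_pos)
    with key[of t] show False by simp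
  qed
  then have "w = 0\<^sub>v n" using scalar_prod_self_pos[OF w] by force
  then have w0: "w $ i = 0" if "i < n" for i using that by simp
  show ?thesis
  proof (rule eq_vecI)
    show "dim_vec (S *\<^sub>v d) = dim_vec (l \<cdot>\<^sub>v d)" using S d by simp
    fix i assume "i < dim_vec (l \<cdot>\<^sub>v d)"
    then have "i < n" using d by simp
    then show "(S *\<^sub>v d) $ i = (l \<cdot>\<^sub>v d) $ i"
      using w0[of i] Sd d S unfolding w_def by simp
  qed
qed

lemma lambda_max_eq:
  assumes M: "max_rayleigh n S l"
  shows "lambda_max S = l"
proof -
  have S: "S \<in> carrier_mat n n"
    and le: "\<And>p. p \<in> carrier_vec n \<Longrightarrow> p \<bullet> (S *\<^sub>v p) \<le> l * (p \<bullet> p)"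
    using M unfolding max_rayleigh_def by auto
  obtain d where d: "d \<in> carrier_vec n" "d \<noteq> 0\<^sub>v n" and eq: "d \<bullet> (S *\<^sub>v d) = l * (d \<bullet> d)"
    using M unfolding max_rayleigh_def by auto
  \<comment> \<open>Finiteness of the spectrum is what makes \<open>Max\<close> in
    \<open>lambda_max\<close> a genuine maximum.\<close>
  have "finite {k. poly (char_poly S) k = 0}"
    by (rule poly_roots_finite) (use degree_monic_char_poly[OF S] in auto)
  then have fin: "finite {k. eigenvalue S k}"
    by (simp add: eigenvalue_root_char_poly[OF S])
  have "eigenvalue S l"
    unfolding eigenvalue_def eigenvector_def
    using max_rayleigh_eigenvector[OF M d(1) eq] d S by auto
  moreover have "k \<le> l" if ev: "eigenvalue S k" for k
  proof -
    obtain v where v: "v \<in> carrier_vec n" "v \<noteq> 0\<^sub>v n" "S *\<^sub>v v = k \<cdot>\<^sub>v v"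
      using ev S unfolding eigenvalue_def eigenvector_def by auto
    have "k * (v \<bullet> v) \<le> l * (v \<bullet> v)" using le[OF v(1)] v by simp
    with scalar_prod_self_pos[OF v(1,2)] show ?thesis by simp
  qed
  ultimately show ?thesis
    unfolding lambda_max_def using fin by (intro Max_eqI) auto
qed

text \<open>A Perron-Frobenius argument. The square of d_j p_i - d_i p_j gives 2 p_i p_j \<le> (d_j
  / d_i) p_i^2 + (d_i / d_j) p_j^2. Weighting by the nonnegative entries of \<open>S\<close> and
  summing, the eigenvector equation collapses the right side to 2 l (p \<bullet> p).\<close>

lemma max_rayleigh_of_positive_eigenvector:
  assumes S: "S \<in> carrier_mat n n" and sym: "transpose_mat S = S" and n: "n \<ge> 1"
    and nonneg: "\<And>i j. i < n \<Longrightarrow> j < n \<Longrightarrow> 0 \<le> S $$ (i, j)"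
    and pos: "\<And>i. i < n \<Longrightarrow> 0 < d i"
    and ev: "\<And>i. i < n \<Longrightarrow> (\<Sum>j<n. S $$ (i, j) * d j) = l * d i"
  shows "max_rayleigh n S l"
  unfolding max_rayleigh_def
proof (intro conjI ballI S sym)
  have symij: "S $$ (i, j) = S $$ (j, i)" if "i < n" "j < n" for i j
    using sym that S by (metis carrier_matD index_transpose_mat(1))
  have qf: "p \<bullet> (S *\<^sub>v p) = (\<Sum>i<n. \<Sum>j<n. S $$ (i, j) * p $ i * p $ j)"
    if "p \<in> carrier_vec n" for p
    using that S by (simp add: scalar_prod_def sum_distrib_left lessThan_atLeast0 mult_ac)
  show "\<exists>p\<in>carrier_vec n. p \<noteq> 0\<^sub>v n \<and> p \<bullet> (S *\<^sub>v p) = l * (p \<bullet> p)"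
  proof (intro bexI conjI)
    show "vec n d \<in> carrier_vec n" by simp
    show "vec n d \<noteq> 0\<^sub>v n" using pos[of 0] n by (auto simp: vec_eq_iff intro!: exI[of _ 0])
    have "vec n d \<bullet> (S *\<^sub>v vec n d) = (\<Sum>i<n. d i * (\<Sum>j<n. S $$ (i, j) * d j))"
      by (subst qf) (auto simp: sum_distrib_left mult_ac)
    also have "\<dots> = (\<Sum>i<n. d i * (l * d i))" by (simp add: ev)
    also have "\<dots> = l * (vec n d \<bullet> vec n d)"
      by (simp add: scalar_prod_def lessThan_atLeast0 sum_distrib_left mult_ac)
    finally show "vec n d \<bullet> (S *\<^sub>v vec n d) = l * (vec n d \<bullet> vec n d)" .
  qed
  fix p :: "real vec" assume p: "p \<in> carrier_vec n"
  \<comment> \<open>One half of the weighted bound; the other half is \<open>a j i\<close> by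
    symmetry of \<open>S\<close>, and both have the same double sum.\<close>
  define a where "a i j = S $$ (i, j) * (d j / d i) * (p $ i)\<^sup>2" for i j
  have amgm: "2 * (S $$ (i, j) * p $ i * p $ j) \<le> a i j + a j i" if ij: "i < n" "j < n" for i j
  proof -
    have di: "d i > 0" "d j > 0" using pos ij by auto
    have "0 \<le> (d j * p $ i - d i * p $ j)\<^sup>2 / (d i * d j)" using di by simp
    also have "\<dots> = (d j / d i) * (p $ i)\<^sup>2 + (d i / d j) * (p $ j)\<^sup>2 - 2 * (p $ i * p $ j)"
      using di by (simp add: field_simps power2_eq_square)
    finally have "S $$ (i, j) * (2 * (p $ i * p $ j)) \<le>
        S $$ (i, j) * ((d j / d i) * (p $ i)\<^sup>2 + (d i / d j) * (p $ j)\<^sup>2)"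
      by (intro mult_left_mono nonneg ij) simp
    then show ?thesis unfolding a_def using symij[OF ij] by (simp add: algebra_simps)
  qed
  have "2 * (p \<bullet> (S *\<^sub>v p)) = (\<Sum>i<n. \<Sum>j<n. 2 * (S $$ (i, j) * p $ i * p $ j))"
    unfolding qf[OF p] by (simp add: sum_distrib_left)
  also have "\<dots> \<le> (\<Sum>i<n. \<Sum>j<n. a i j + a j i)"
    by (intro sum_mono) (use amgm in auto)
  also have "\<dots> = 2 * (\<Sum>i<n. \<Sum>j<n. a i j)"
    using sum.swap[of "\<lambda>i j. a j i" "{..<n}" "{..<n}"] by (simp add: sum.distrib)
  also have "(\<Sum>i<n. \<Sum>j<n. a i j) = (\<Sum>i<n. (p $ i)\<^sup>2 / d i * (\<Sum>j<n. S $$ (i, j) * d j))"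
    unfolding a_def by (simp add: sum_distrib_left mult_ac)
  also have "\<dots> = (\<Sum>i<n. l * (p $ i)\<^sup>2)"
    by (rule sum.cong) (use pos in \<open>auto simp: ev less_imp_neq[THEN not_sym]\<close>)
  also have "\<dots> = l * (p \<bullet> p)"
    using p by (simp add: scalar_prod_def lessThan_atLeast0 sum_distrib_left power2_eq_square)
  finally show "p \<bullet> (S *\<^sub>v p) \<le> l * (p \<bullet> p)" by simp
qed

section \<open>Positive definiteness of complexified real matrices\<close>

lemma Re_hermitian_form_of_real:
  fixes p :: "complex vec"
  assumes M: "M \<in> carrier_mat n n" and p: "p \<in> carrier_vec n"
  shows "Re (conjugate p \<bullet> (map_mat complex_of_real M *\<^sub>v p)) =
    map_vec Re p \<bullet> (M *\<^sub>v map_vec Re p) + map_vec Im p \<bullet> (M *\<^sub>v map_vec Im p)"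
proof -
  have "Re (conjugate p \<bullet> (map_mat complex_of_real M *\<^sub>v p)) =
    (\<Sum>i=0..<n. \<Sum>j=0..<n. Re (p $ i) * (M $$ (i, j) * Re (p $ j)) + Im (p $ i) * (M $$ (i, j) * Im (p $ j)))"
    using M p by (simp add: scalar_prod_def sum_distrib_left)
  also have "\<dots> = map_vec Re p \<bullet> (M *\<^sub>v map_vec Re p) + map_vec Im p \<bullet> (M *\<^sub>v map_vec Im p)"
    using M p by (simp add: scalar_prod_def sum_distrib_left sum.distrib)
  finally show ?thesis .
qed

lemma mat_adjoint_of_real:
  assumes M: "M \<in> carrier_mat n n" and sym: "transpose_mat M = M"
  shows "mat_adjoint (map_mat complex_of_real M) = map_mat complex_of_real M"
proof (rule eq_matI)
  show "dim_row (mat_adjoint (map_mat complex_of_real M)) = dim_row (map_mat complex_of_real M)"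
    "dim_col (mat_adjoint (map_mat complex_of_real M)) = dim_col (map_mat complex_of_real M)"
    using M unfolding mat_adjoint_def by auto
  fix i j assume "i < dim_row (map_mat complex_of_real M)" "j < dim_col (map_mat complex_of_real M)"
  then have ij: "i < n" "j < n" using M by auto
  have "M $$ (i, j) = M $$ (j, i)"
    using sym ij M by (metis carrier_matD index_transpose_mat(1))
  then show "mat_adjoint (map_mat complex_of_real M) $$ (i, j) = map_mat complex_of_real M $$ (i, j)"
    using M ij unfolding mat_adjoint_def by (simp add: mat_of_rows_index)
qed

text \<open>The real and imaginary parts of a complex vector contribute separately to the form, and
  for a nonzero vector at least one of them is nonzero.\<close>

lemma positive_definite_of_real_iff:
  assumes M: "M \<in> carrier_mat n n" and sym: "transpose_mat M = M"
  shows "positive_definite (map_mat complex_of_real M) \<longleftrightarrow>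
    (\<forall>p\<in>carrier_vec n. p \<noteq> 0\<^sub>v n \<longrightarrow> 0 < p \<bullet> (M *\<^sub>v p))" (is "?L \<longleftrightarrow> ?R")
proof
  assume L: ?L
  show ?R
  proof (intro ballI impI)
    fix p :: "real vec" assume p: "p \<in> carrier_vec n" "p \<noteq> 0\<^sub>v n"
    let ?q = "map_vec complex_of_real p"
    have q: "?q \<in> carrier_vec n" using p by simp
    have "?q \<noteq> 0\<^sub>v n" using p by (auto simp: vec_eq_iff)
    then have "0 < Re (conjugate ?q \<bullet> (map_mat complex_of_real M *\<^sub>v ?q))"
      using L q M unfolding positive_definite_def by auto
    moreover have "map_vec Re ?q = p" "map_vec Im ?q = 0\<^sub>v n"
      using p by (auto simp: vec_eq_iff)
    ultimately show "0 < p \<bullet> (M *\<^sub>v p)"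
      using Re_hermitian_form_of_real[OF M q] M by simp
  qed
next
  assume R: ?R
  then have R0: "0 \<le> p \<bullet> (M *\<^sub>v p)" if "p \<in> carrier_vec n" for p
    using that M by (cases "p = 0\<^sub>v n") (auto intro: less_imp_le)
  show ?L
    unfolding positive_definite_def
  proof (intro conjI ballI impI mat_adjoint_of_real[OF M sym])
    fix p :: "complex vec" assume "p \<in> carrier_vec (dim_row (map_mat complex_of_real M))"
      "p \<noteq> 0\<^sub>v (dim_row (map_mat complex_of_real M))"
    then have p: "p \<in> carrier_vec n" "p \<noteq> 0\<^sub>v n" using M by auto
    have c: "map_vec Re p \<in> carrier_vec n" "map_vec Im p \<in> carrier_vec n" using p by auto
    have "map_vec Re p \<noteq> 0\<^sub>v n \<or> map_vec Im p \<noteq> 0\<^sub>v n"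
      using p by (auto simp: vec_eq_iff complex_eq_iff)
    then show "0 < Re (conjugate p \<bullet> (map_mat complex_of_real M *\<^sub>v p))"
      unfolding Re_hermitian_form_of_real[OF M p(1)]
      using R R0 c by (auto intro: add_pos_nonneg add_nonneg_pos)
  qed
qed

lemma smult_mat_mult_vec:
  fixes M :: "'a::comm_semiring_0 mat"
  assumes "M \<in> carrier_mat m n" "v \<in> carrier_vec n"
  shows "(c \<cdot>\<^sub>m M) *\<^sub>v v = c \<cdot>\<^sub>v (M *\<^sub>v v)"
  using assms by (intro eq_vecI) (auto simp: scalar_prod_def sum_distrib_left mult_ac)

text \<open>The smallest value of the form on unit vectors is c (a - b l): as b \<ge> 0, the upper
  bound on the Rayleigh quotient of \<open>S\<close> becomes a lower bound here, and the maximiser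
  \<open>d\<close> shows that it is attained.\<close>

lemma positive_definite_weight_iff:
  assumes R: "max_rayleigh n S l" and b: "0 \<le> b" and c: "0 < c"
  shows "positive_definite (map_mat complex_of_real (c \<cdot>\<^sub>m (a \<cdot>\<^sub>m 1\<^sub>m n - b \<cdot>\<^sub>m S))) \<longleftrightarrow> b * l < a"
proof -
  have S: "S \<in> carrier_mat n n" and sym: "transpose_mat S = S"
    and le: "\<And>p. p \<in> carrier_vec n \<Longrightarrow> p \<bullet> (S *\<^sub>v p) \<le> l * (p \<bullet> p)"
    using R unfolding max_rayleigh_def by auto
  obtain d where d: "d \<in> carrier_vec n" "d \<noteq> 0\<^sub>v n" and eq: "d \<bullet> (S *\<^sub>v d) = l * (d \<bullet> d)"
    using R unfolding max_rayleigh_def by auto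
  let ?M = "c \<cdot>\<^sub>m (a \<cdot>\<^sub>m 1\<^sub>m n - b \<cdot>\<^sub>m S)"
  have M: "?M \<in> carrier_mat n n" using S by auto
  have symij: "S $$ (i, j) = S $$ (j, i)" if "i < n" "j < n" for i j
    using sym that S by (metis carrier_matD index_transpose_mat(1))
  have symM: "transpose_mat ?M = ?M"
    using S symij by (intro eq_matI) auto
  have form: "p \<bullet> (?M *\<^sub>v p) = c * (a * (p \<bullet> p) - b * (p \<bullet> (S *\<^sub>v p)))" if p: "p \<in> carrier_vec n" for p
  proof -
    have "?M *\<^sub>v p = c \<cdot>\<^sub>v (a \<cdot>\<^sub>v p - b \<cdot>\<^sub>v (S *\<^sub>v p))"
      using S p
      by (subst smult_mat_mult_vec[of _ n n])
        (auto simp: smult_mat_mult_vec[of _ n n] minus_mult_distrib_mat_vec[of _ n n])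
    then show ?thesis using S p by (simp add: scalar_prod_minus_distrib[of p n])
  qed
  show ?thesis
    unfolding positive_definite_of_real_iff[OF M symM]
  proof
    assume "\<forall>p\<in>carrier_vec n. p \<noteq> 0\<^sub>v n \<longrightarrow> 0 < p \<bullet> (?M *\<^sub>v p)"
    then have "0 < c * (a * (d \<bullet> d) - b * (l * (d \<bullet> d)))" using d form[OF d(1)] eq by auto
    then have "0 < (a - b * l) * (d \<bullet> d)" using c by (simp add: zero_less_mult_iff algebra_simps)
    then show "b * l < a" using scalar_prod_self_pos[OF d] by (simp add: zero_less_mult_iff)
  next
    assume ba: "b * l < a"
    show "\<forall>p\<in>carrier_vec n. p \<noteq> 0\<^sub>v n \<longrightarrow> 0 < p \<bullet> (?M *\<^sub>v p)"
    proof (intro ballI impI)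
      fix p :: "real vec" assume p: "p \<in> carrier_vec n" "p \<noteq> 0\<^sub>v n"
      have "b * (p \<bullet> (S *\<^sub>v p)) \<le> b * (l * (p \<bullet> p))" using le[OF p(1)] b by (rule mult_left_mono)
      also have "\<dots> < a * (p \<bullet> p)" using ba scalar_prod_self_pos[OF p] by simp
      finally show "0 < p \<bullet> (?M *\<^sub>v p)" unfolding form[OF p(1)] using c by simp
    qed
  qed
qed

section \<open>Single-letter functions and the Hagedorn point\<close>

text \<open>The square of the root in (0,1) of 1 - 4 s + s^2, with s = sqrt x; numerically 7 - 4
  sqrt 3.\<close>

definition x_Hag :: real where "x_Hag = (2 - sqrt 3)\<^sup>2"

lemma two_minus_sqrt3_bounds: "0 < 2 - sqrt 3" "2 - sqrt 3 < 1"
proof -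
  have "sqrt 3 < sqrt 4" "sqrt 1 < sqrt 3" by (rule real_sqrt_less_mono; simp)+
  then show "0 < 2 - sqrt 3" "2 - sqrt 3 < 1" by simp_all
qed

text \<open>The substitution x^n = s^2 turns the fractional power in \<open>z_psi\<close> into s^3,
  so all letter functions become rational in s.\<close>

lemma square_powr_three_halves:
  fixes s :: real
  assumes s: "0 < s"
  shows "(s\<^sup>2) powr (3 / 2) = s ^ 3"
proof -
  have "(s\<^sup>2) powr (3 / 2) = (s powr 2) powr (3 / 2)" using s by simp
  also have "\<dots> = s ^ 3" using s by (simp only: powr_powr) simp
  finally show ?thesis .
qed

text \<open>With \<open>x\<^sup>n = s\<^sup>2\<close> and \<open>\<sigma> = (-1)\<^sup>n\<^sup>+\<^sup>1\<close>, this is the smallest eigenvalue, up to the factor \<open>1 / n\<close>,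
  of the weight matrix of the \<open>n\<close>-th Gaussian factor.\<close>

lemma letter_factorisation:
  fixes s \<sigma> :: real
  assumes s: "0 < s" "s < 1" and \<sigma>: "\<sigma> = 1 \<or> \<sigma> = -1"
  shows "1 - (z_A (s\<^sup>2) + \<sigma> * z_psi (s\<^sup>2)) - 3 * (2 * z_phi (s\<^sup>2) + \<sigma> * z_psi (s\<^sup>2))
    = (1 + \<sigma> * s) ^ 4 * (1 - 4 * \<sigma> * s + s\<^sup>2) / (1 - s\<^sup>2) ^ 3"
proof -
  note p = square_powr_three_halves[OF s(1)]
  have "s\<^sup>2 < 1" using s by (simp add: power_less_one_iff)
  then have D: "(1 - s\<^sup>2) ^ 3 \<noteq> 0" by simp
  have "1 - (z_A (s\<^sup>2) + \<sigma> * z_psi (s\<^sup>2)) - 3 * (2 * z_phi (s\<^sup>2) + \<sigma> * z_psi (s\<^sup>2)) =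
    ((1 - s\<^sup>2) ^ 3 - (6 * (s\<^sup>2)\<^sup>2 - 2 * (s\<^sup>2) ^ 3) - 6 * (s\<^sup>2 * (1 + s\<^sup>2)) - 16 * \<sigma> * s ^ 3) / (1 - s\<^sup>2) ^ 3"
    unfolding z_A_def z_psi_def z_phi_def p using D by (simp add: divide_simps)
  \<comment> \<open>Both numerators are polynomials in s; they agree because \<sigma>^2 = 1, checked
    for each sign.\<close>
  also have "(1 - s\<^sup>2) ^ 3 - (6 * (s\<^sup>2)\<^sup>2 - 2 * (s\<^sup>2) ^ 3) - 6 * (s\<^sup>2 * (1 + s\<^sup>2)) - 16 * \<sigma> * s ^ 3
     = (1 + \<sigma> * s) ^ 4 * (1 - 4 * \<sigma> * s + s\<^sup>2)"
    using \<sigma> by (elim disjE) (simp add: algebra_simps eval_nat_numeral)+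
  finally show ?thesis .
qed

lemma letter_quadratic_factor:
  "1 - 4 * s + s\<^sup>2 = ((2 - sqrt 3) - s) * ((2 + sqrt 3) - s)"
  by (simp add: algebra_simps power2_eq_square)

text \<open>On (0,1) every factor other than (2 - sqrt 3) - s is positive. Stating this for
  \<open>sgn\<close> serves both the equation (value zero) and the inequality (value at most
  zero).\<close>

lemma odd_letter_sign:
  assumes s: "0 < s" "s < 1" "odd n"
    and y: "x ^ n = s\<^sup>2"
  shows "sgn (1 - z_v x n - 3 * z_c x n) = sgn ((2 - sqrt 3) - s)"
proof -
  have "s\<^sup>2 < 1" using s by (simp add: power_less_one_iff)
  then have pos: "0 < (1 + s) ^ 4 * ((2 + sqrt 3) - s) / (1 - s\<^sup>2) ^ 3"
    using s by (intro divide_pos_pos mult_pos_pos) (auto simp: less_le_trans[of s 1] add_strict_increasing2 add_increasing2)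
  have "1 - z_v x n - 3 * z_c x n = ((2 - sqrt 3) - s) * ((1 + s) ^ 4 * ((2 + sqrt 3) - s) / (1 - s\<^sup>2) ^ 3)"
    using letter_factorisation[OF s(1,2), of 1] s(3) y letter_quadratic_factor[of s]
    unfolding z_v_def z_c_def by simp
  then show ?thesis using pos by (simp only: sgn_mult sgn_pos mult_1_right)
qed

text \<open>With \<sigma> = -1 the quadratic factor is 1 + 4 s + s^2, which has no positive
  root.\<close>

lemma even_letter_pos:
  assumes s: "0 < s" "s < 1" "even n"
    and y: "x ^ n = s\<^sup>2"
  shows "0 < 1 - z_v x n - 3 * z_c x n"
proof -
  have "s\<^sup>2 < 1" using s by (simp add: power_less_one_iff)
  then have pos: "0 < (1 - s) ^ 4 * (1 + 4 * s + s\<^sup>2) / (1 - s\<^sup>2) ^ 3"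
    using s by (intro divide_pos_pos mult_pos_pos) (auto intro!: add_pos_pos)
  then show ?thesis
    using letter_factorisation[OF s(1,2), of "-1"] s(3) y
    unfolding z_v_def z_c_def by simp
qed

lemma sqrt_power_letter:
  assumes x: "0 < x" "x < (1::real)" and n: "n \<ge> 1"
  shows "0 < sqrt x ^ n" "sqrt x ^ n < 1" "x ^ n = (sqrt x ^ n)\<^sup>2"
  using x n by (auto simp: power_less_one_iff power_mult[symmetric] mult.commute[of n]) (simp add: power_mult)

text \<open>The numerator is 2 s^2 (1 + \<sigma> s)^2 with \<sigma> = 1 or -1. This supplies the
  condition 0 \<le> b of \<open>positive_definite_weight_iff\<close>.\<close>

lemma z_c_nonneg:
  assumes x: "0 < x" "x < 1" and n: "n \<ge> 1"
  shows "0 \<le> z_c x n"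
proof -
  define s where "s = sqrt x ^ n"
  have s: "0 < s" "s < 1" and y: "x ^ n = s\<^sup>2" unfolding s_def by (rule sqrt_power_letter[OF x n])+
  note p = square_powr_three_halves[OF s(1)]
  have D: "0 < (1 - s\<^sup>2) ^ 3" using s by (simp add: power_less_one_iff)
  have "z_c x n = 2 * s\<^sup>2 * (1 + s\<^sup>2 + 2 * (-1) ^ (n + 1) * s) / (1 - s\<^sup>2) ^ 3"
    unfolding z_c_def z_phi_def z_psi_def y p using D
    by (simp add: divide_simps) (simp add: algebra_simps power2_eq_square power3_eq_cube)
  moreover have "0 \<le> 1 + s\<^sup>2 + 2 * (-1) ^ (n + 1) * s"
  proof (cases "odd n")
    case True
    then show ?thesis using s by simp
  next
    case False
    then have "1 + s\<^sup>2 + 2 * (-1) ^ (n + 1) * s = (1 - s)\<^sup>2" by (simp add: power2_eq_square algebra_simps)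
    then show ?thesis by simp
  qed
  ultimately show ?thesis using D s by simp
qed

text \<open>The combination z_v + 3 z_c is the letter count of N = 4 super-Yang-Mills, one vector
  and three chiral multiplets.\<close>

lemma N4_letter_equation_iff:
  assumes x: "0 < x" "x < 1"
  shows "1 - z_v x 1 = 3 * z_c x 1 \<longleftrightarrow> x = x_Hag"
proof -
  have "sgn (1 - z_v x 1 - 3 * z_c x 1) = sgn ((2 - sqrt 3) - sqrt x)"
    using x by (intro odd_letter_sign) (auto simp: real_sqrt_lt_1_iff)
  then have "1 - z_v x 1 = 3 * z_c x 1 \<longleftrightarrow> sqrt x = 2 - sqrt 3"
    by (metis diff_eq_diff_eq eq_iff_diff_eq_0 sgn_zero_iff)
  also have "\<dots> \<longleftrightarrow> x = x_Hag" using x two_minus_sqrt3_bounds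
    unfolding x_Hag_def by (metis less_imp_le real_sqrt_pow2 real_sqrt_unique)
  finally show ?thesis .
qed

lemma x_Hag_bounds: "0 < x_Hag" "x_Hag < 1"
  using two_minus_sqrt3_bounds unfolding x_Hag_def by (auto simp: power_less_one_iff)

text \<open>The weight enters only through the convergence criterion, so the orbifold and the affine
  weights can share the argument. The set found contains its least element \<open>x_Hag\<close>,
  which is thus the Hagedorn point.\<close>

lemma divergence_points_eq:
  assumes K: "\<And>x n. 0 < x \<Longrightarrow> x < 1 \<Longrightarrow> n \<ge> 1 \<Longrightarrow>
      positive_definite (K x n) \<longleftrightarrow> 3 * z_c x n < 1 - z_v x n"
  shows "divergence_points K = {x_Hag..<1}"
proof (rule Set.set_eqI)
  fix x
  have "(\<exists>n\<ge>1. \<not> positive_definite (K x n)) \<longleftrightarrow> x_Hag \<le> x" if x: "0 < x" "x < 1"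
  proof
    assume "\<exists>n\<ge>1. \<not> positive_definite (K x n)"
    then obtain n where n: "n \<ge> 1" and "\<not> positive_definite (K x n)" by blast
    then have neg: "1 - z_v x n - 3 * z_c x n \<le> 0" using K[OF x n] by simp
    note s = sqrt_power_letter[OF x n]
    have "odd n" using even_letter_pos[OF s(1,2) _ s(3)] neg by force
    from odd_letter_sign[OF s(1,2) this s(3)] neg have "2 - sqrt 3 \<le> sqrt x ^ n"
      by (smt (verit) sgn_if)
    \<comment> \<open>Powers of sqrt x < 1 decrease, so a divergence at any odd n forces sqrt x
      itself past the threshold.\<close>
    also have "\<dots> \<le> sqrt x" using x n power_decreasing[of 1 n "sqrt x"] by simp
    finally show "x_Hag \<le> x" unfolding x_Hag_def using two_minus_sqrt3_bounds x by (metis less_imp_le power_mono real_sqrt_pow2)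
  next
    assume "x_Hag \<le> x"
    then have "2 - sqrt 3 \<le> sqrt x" unfolding x_Hag_def by (rule real_le_rsqrt)
    moreover have "sgn (1 - z_v x 1 - 3 * z_c x 1) = sgn ((2 - sqrt 3) - sqrt x)"
      using x by (intro odd_letter_sign) (auto simp: real_sqrt_lt_1_iff)
    ultimately have "\<not> positive_definite (K x 1)"
      using K[OF x, of 1] by (smt (verit) order_refl sgn_if)
    then show "\<exists>n\<ge>1. \<not> positive_definite (K x n)" by blast
  qed
  then show "x \<in> divergence_points K \<longleftrightarrow> x \<in> {x_Hag..<1}"
    using x_Hag_bounds unfolding divergence_points_def by auto
qed

lemma is_Hagedorn_point_iff:
  assumes "\<And>x n. 0 < x \<Longrightarrow> x < 1 \<Longrightarrow> n \<ge> 1 \<Longrightarrow>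
      positive_definite (K x n) \<longleftrightarrow> 3 * z_c x n < 1 - z_v x n"
  shows "is_Hagedorn_point K x \<longleftrightarrow> x = x_Hag"
proof -
  have D: "divergence_points K = {x_Hag..<1}" by (rule divergence_points_eq) (rule assms)
  show ?thesis
    unfolding is_Hagedorn_point_def D using x_Hag_bounds by (auto intro: antisym)
qed

text \<open>As \<open>x_Hag\<close> lies in (0,1), its logarithm is negative and the solution of exp
  (-1/T) = x_Hag is a positive temperature.\<close>

lemma is_Hagedorn_temperature_iff:
  assumes "\<And>x n. 0 < x \<Longrightarrow> x < 1 \<Longrightarrow> n \<ge> 1 \<Longrightarrow>
      positive_definite (K x n) \<longleftrightarrow> 3 * z_c x n < 1 - z_v x n"
  shows "is_Hagedorn_temperature K T \<longleftrightarrow> T = - 1 / ln x_Hag"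
proof -
  have ln: "ln x_Hag < 0" using x_Hag_bounds by simp
  have "exp (- 1 / T) = x_Hag \<longleftrightarrow> - 1 / T = ln x_Hag"
    using x_Hag_bounds by (metis exp_ln ln_exp)
  moreover have "T > 0 \<and> - 1 / T = ln x_Hag \<longleftrightarrow> T = - 1 / ln x_Hag"
  proof
    assume T: "T > 0 \<and> - 1 / T = ln x_Hag"
    then show "T = - 1 / ln x_Hag" by (simp add: T[THEN conjunct2, symmetric])
  next
    assume "T = - 1 / ln x_Hag"
    then show "T > 0 \<and> - 1 / T = ln x_Hag" using ln by (simp add: divide_neg_neg)
  qed
  ultimately show ?thesis
    unfolding is_Hagedorn_temperature_def using is_Hagedorn_point_iff[of K] assms by simp
qed

section \<open>Affine quivers\<close>

text \<open>Marks of Dynkin diagrams are natural numbers; with everything in \<open>nat\<close> the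
  eigenvector equations become plain computations.\<close>

lemma max_rayleigh_of_nat_eigenvector:
  fixes d :: "nat \<Rightarrow> nat"
  assumes B: "B \<in> carrier_mat n n" and n: "n \<ge> 1"
    and sym: "\<And>i j. i < n \<Longrightarrow> j < n \<Longrightarrow> B $$ (i, j) = B $$ (j, i)"
    and pos: "\<And>i. i < n \<Longrightarrow> 0 < d i"
    and ev: "\<And>i. i < n \<Longrightarrow> (\<Sum>j<n. B $$ (i, j) * d j) = l * d i"
  shows "max_rayleigh n (map_mat real B) (real l)"
proof (rule max_rayleigh_of_positive_eigenvector[where d = "\<lambda>i. real (d i)"])
  show "transpose_mat (map_mat real B) = map_mat real B"
    using B sym by (intro eq_matI) auto
  fix i assume i: "i < n"
  have "(\<Sum>j<n. map_mat real B $$ (i, j) * real (d j)) = real (\<Sum>j<n. B $$ (i, j) * d j)"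
    using B i by simp
  then show "(\<Sum>j<n. map_mat real B $$ (i, j) * real (d j)) = real l * real (d i)"
    by (simp add: ev[OF i])
qed (use B n pos in auto)

lemma graph_adjacency_max_rayleigh:
  fixes d :: "nat \<Rightarrow> nat"
  assumes n: "n \<ge> 1" and pos: "\<And>i. i < n \<Longrightarrow> 0 < d i"
    and ev: "\<And>i. i < n \<Longrightarrow> (\<Sum>j<n. if (i, j) \<in> E \<or> (j, i) \<in> E then d j else 0) = l * d i"
  shows "max_rayleigh n (map_mat real (graph_adjacency n E)) (real l)"
proof (rule max_rayleigh_of_nat_eigenvector[OF _ n _ pos])
  fix i assume i: "i < n"
  have "(\<Sum>j<n. graph_adjacency n E $$ (i, j) * d j) =
      (\<Sum>j<n. if (i, j) \<in> E \<or> (j, i) \<in> E then d j else 0)"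
    using i by (intro sum.cong) (auto simp: graph_adjacency_def)
  then show "(\<Sum>j<n. graph_adjacency n E $$ (i, j) * d j) = l * d i"
    using ev[OF i] by simp
qed (auto simp: graph_adjacency_def)

text \<open>All marks of the cycle are 1: each node has one successor and one predecessor, counted
  with multiplicity when they coincide.\<close>

lemma affine_A_max_rayleigh:
  assumes k: "k \<ge> 1"
  shows "max_rayleigh k (map_mat real (mat k k (\<lambda>(i, j).
     (if j = (i + 1) mod k then 1 else 0) + (if i = (j + 1) mod k then 1 else 0)))) (real 2)"
proof (rule max_rayleigh_of_nat_eigenvector[OF _ k, where d = "\<lambda>_. 1"])
  fix i assume i: "i < k"
  \<comment> \<open>The predecessor of i on the cycle, solved for j so that the sum has a single
    nonzero term; node 0 wraps around to k - 1.\<close>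
  have "i = (j + 1) mod k \<longleftrightarrow> j = (if i = 0 then k - 1 else i - 1)" if "j < k" for j
    using that i by (cases "j + 1 = k") auto
  then have "(\<Sum>j<k. if i = (j + 1) mod k then 1 else 0 :: nat) =
      (\<Sum>j<k. if j = (if i = 0 then k - 1 else i - 1) then 1 else 0)"
    by (intro sum.cong) auto
  also have "\<dots> = 1" using i by (subst sum.delta) auto
  finally have "(\<Sum>j<k. if i = (j + 1) mod k then 1 else 0 :: nat) = 1" .
  moreover have "(\<Sum>j<k. if j = (i + 1) mod k then 1 else 0 :: nat) = 1"
    using k by (subst sum.delta) auto
  ultimately show "(\<Sum>j<k. mat k k (\<lambda>(i, j). (if j = (i + 1) mod k then 1 else 0)
      + (if i = (j + 1) mod k then 1 else 0)) $$ (i, j) * 1) = (2::nat) * 1"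
    using i by (simp add: sum.distrib)
qed auto

text \<open>The marks are 1 at the four end nodes 0, 1, k - 1, k and 2 on the chain from 2 to k -
  2.\<close>

lemma affine_D_max_rayleigh:
  assumes k: "k \<ge> 4"
  shows "max_rayleigh (k + 1) (map_mat real (graph_adjacency (k + 1)
     ({(0, 2), (1, 2), (k - 2, k - 1), (k - 2, k)} \<union> {(i, i + 1) | i. 2 \<le> i \<and> i < k - 2}))) (real 2)"
proof (rule graph_adjacency_max_rayleigh[where d = "\<lambda>i. if 2 \<le> i \<and> i \<le> k - 2 then 2 else 1"])
  fix i assume i: "i < k + 1"
  define d where "d = (\<lambda>i::nat. if 2 \<le> i \<and> i \<le> k - 2 then 2 else 1 :: nat)"
  define E where "E = {(0, 2), (1, 2), (k - 2, k - 1), (k - 2, k)} \<union> {(i, i + 1) | i. 2 \<le> i \<and> i < k - 2}"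
  define N where "N = {j \<in> {..<k + 1}. (i, j) \<in> E \<or> (j, i) \<in> E}"
  \<comment> \<open>Writing k = m + 4 removes the truncated subtractions.\<close>
  obtain m where m: "k = m + 4" using k le_Suc_ex by (metis add.commute)
  have E: "(a, b) \<in> E \<longleftrightarrow> a = 0 \<and> b = 2 \<or> a = 1 \<and> b = 2 \<or> a = m + 2 \<and> (b = m + 3 \<or> b = m + 4)
    \<or> b = a + 1 \<and> 2 \<le> a \<and> a < m + 2" for a b
    unfolding E_def m by auto
  have d: "d a = (if 2 \<le> a \<and> a \<le> m + 2 then 2 else 1)" for a
    unfolding d_def m by simp
  \<comment> \<open>The four ends, the branch nodes and the interior of the chain. For m = 0 the two
    branch nodes merge into one with four neighbours.\<close>
  consider "i = 0" | "i = 1" | "i = m + 3" | "i = m + 4" | "i = 2" "m = 0" | "i = 2" "m > 0"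
    | "i = m + 2" "m > 0" | "2 < i" "i < m + 2"
    using i unfolding m by fastforce
  then have "sum d N = 2 * d i"
  proof cases
    case 1
    then have "N = {2}" unfolding N_def E m by auto
    then show ?thesis using 1 by (simp add: d)
  next
    case 2
    then have "N = {2}" unfolding N_def E m by auto
    then show ?thesis using 2 by (simp add: d)
  next
    case 3
    then have "N = {m + 2}" unfolding N_def E m by auto
    then show ?thesis using 3 by (simp add: d)
  next
    case 4
    then have "N = {m + 2}" unfolding N_def E m by auto
    then show ?thesis using 4 by (simp add: d)
  next
    case 5
    then have "N = {0, 1, 3, 4}" unfolding N_def E m by auto
    then show ?thesis using 5 by (simp add: d)
  next
    case 6
    then have "N = {0, 1, 3}" unfolding N_def E m by auto
    then show ?thesis using 6 by (simp add: d)
  next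
    case 7
    then have "N = {m + 1, m + 3, m + 4}" unfolding N_def E m by auto
    then show ?thesis using 7 by (simp add: d)
  next
    case 8
    then have "N = {i - 1, i + 1}" unfolding N_def E m by auto
    moreover have "i - 1 \<noteq> i + 1" by simp
    ultimately show ?thesis using 8 by (auto simp: d)
  qed
  then have "(\<Sum>j<k + 1. if (i, j) \<in> E \<or> (j, i) \<in> E then d j else 0) = 2 * d i"
    unfolding N_def by (simp only: sum.inter_filter[OF finite_lessThan])
  then show "(\<Sum>j<k + 1. if (i, j) \<in> {(0, 2), (1, 2), (k - 2, k - 1), (k - 2, k)} \<union> {(i, i + 1) | i. 2 \<le> i \<and> i < k - 2}
      \<or> (j, i) \<in> {(0, 2), (1, 2), (k - 2, k - 1), (k - 2, k)} \<union> {(i, i + 1) | i. 2 \<le> i \<and> i < k - 2}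
      then if 2 \<le> j \<and> j \<le> k - 2 then 2 else 1 else 0) = (2::nat) * (if 2 \<le> i \<and> i \<le> k - 2 then 2 else 1)"
    unfolding E_def d_def .
qed auto

lemma lessThan_numeral:
  "{..<7::nat} = {0,1,2,3,4,5,6}"
  "{..<8::nat} = {0,1,2,3,4,5,6,7}"
  "{..<9::nat} = {0,1,2,3,4,5,6,7,8}"
  by auto

lemma affine_E6_max_rayleigh:
  "max_rayleigh 7 (map_mat real (graph_adjacency 7
     {(0,1), (1,2), (0,3), (3,4), (0,5), (5,6)})) (real 2)"
\<comment> \<open>The marks: 3 at the trivalent node 0, descending by 1 along each of the three
  arms.\<close>
proof (rule graph_adjacency_max_rayleigh[where d = "\<lambda>i. [3,2,1,2,1,2,1] ! i"])
  fix i :: nat assume "i < 7"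
  then have i: "i \<in> {0,1,2,3,4,5,6}" by auto
  show "(0::nat) < [3,2,1,2,1,2,1] ! i" using i by (elim insertE emptyE) simp_all
  show "(\<Sum>j<7. if (i, j) \<in> {(0,1), (1,2), (0,3), (3,4), (0,5), (5,6)}
      \<or> (j, i) \<in> {(0,1), (1,2), (0,3), (3,4), (0,5), (5,6)}
      then [3,2,1,2,1,2,1] ! j else 0) = (2::nat) * [3,2,1,2,1,2,1] ! i"
    unfolding lessThan_numeral using i by (elim insertE emptyE) simp_all
qed simp

lemma affine_E7_max_rayleigh:
  "max_rayleigh 8 (map_mat real (graph_adjacency 8
     {(0,1), (1,2), (2,3), (0,4), (4,5), (5,6), (0,7)})) (real 2)"
\<comment> \<open>Mark 4 at the trivalent node; the arms descend in steps of 1, 1 and 2.\<close>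
proof (rule graph_adjacency_max_rayleigh[where d = "\<lambda>i. [4,3,2,1,3,2,1,2] ! i"])
  fix i :: nat assume "i < 8"
  then have i: "i \<in> {0,1,2,3,4,5,6,7}" by auto
  show "(0::nat) < [4,3,2,1,3,2,1,2] ! i" using i by (elim insertE emptyE) simp_all
  show "(\<Sum>j<8. if (i, j) \<in> {(0,1), (1,2), (2,3), (0,4), (4,5), (5,6), (0,7)}
      \<or> (j, i) \<in> {(0,1), (1,2), (2,3), (0,4), (4,5), (5,6), (0,7)}
      then [4,3,2,1,3,2,1,2] ! j else 0) = (2::nat) * [4,3,2,1,3,2,1,2] ! i"
    unfolding lessThan_numeral using i by (elim insertE emptyE) simp_all
qed simp

lemma affine_E8_max_rayleigh:
  "max_rayleigh 9 (map_mat real (graph_adjacency 9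
     {(0,1), (1,2), (2,3), (3,4), (4,5), (0,6), (6,7), (0,8)})) (real 2)"
\<comment> \<open>Mark 6 at the trivalent node; the arms descend in steps of 1, 2 and 3.\<close>
proof (rule graph_adjacency_max_rayleigh[where d = "\<lambda>i. [6,5,4,3,2,1,4,2,3] ! i"])
  fix i :: nat assume "i < 9"
  then have i: "i \<in> {0,1,2,3,4,5,6,7,8}" by auto
  show "(0::nat) < [6,5,4,3,2,1,4,2,3] ! i" using i by (elim insertE emptyE) simp_all
  show "(\<Sum>j<9. if (i, j) \<in> {(0,1), (1,2), (2,3), (3,4), (4,5), (0,6), (6,7), (0,8)}
      \<or> (j, i) \<in> {(0,1), (1,2), (2,3), (3,4), (4,5), (0,6), (6,7), (0,8)}
      then [6,5,4,3,2,1,4,2,3] ! j else 0) = (2::nat) * [6,5,4,3,2,1,4,2,3] ! i"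
    unfolding lessThan_numeral using i by (elim insertE emptyE) simp_all
qed simp

lemma affine_ADE_max_rayleigh:
  assumes "affine_ADE B"
  shows "max_rayleigh (dim_row B) (map_mat real B) 2"
  using assms
proof cases
  case (affine_A k)
  then show ?thesis using affine_A_max_rayleigh[of k] by simp
next
  case (affine_D k)
  then show ?thesis using affine_D_max_rayleigh[of k] by (simp add: graph_adjacency_def)
qed (use affine_E6_max_rayleigh affine_E7_max_rayleigh affine_E8_max_rayleigh in \<open>simp_all add: graph_adjacency_def\<close>)

section \<open>Orthogonality of irreducible characters\<close>

lemma sum_prod_swap: "(\<Sum>a\<in>A. f a * (\<Sum>b\<in>B. g a b)) = (\<Sum>b\<in>B. \<Sum>a\<in>A. f a * g a b :: 'a::comm_semiring_0)"
  by (subst sum.swap) (simp add: sum_distrib_left)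

lemma index_mult_mat_sum:
  assumes "A \<in> carrier_mat n m" "B \<in> carrier_mat m l" "i < n" "j < l"
  shows "(A * B) $$ (i, j) = (\<Sum>k<m. A $$ (i, k) * B $$ (k, j))"
  using assms by (simp add: scalar_prod_def lessThan_atLeast0)

lemma mat_trace_mult_commute:
  fixes A :: "'a::comm_semiring_0 mat"
  assumes A: "A \<in> carrier_mat n m" and B: "B \<in> carrier_mat m n"
  shows "mat_trace (A * B) = mat_trace (B * A)"
proof -
  have "mat_trace (A * B) = (\<Sum>i<n. \<Sum>k<m. A $$ (i, k) * B $$ (k, i))"
    unfolding mat_trace_def using A B by (simp add: index_mult_mat_sum[OF A B] del: index_mult_mat(1))
  also have "\<dots> = (\<Sum>k<m. \<Sum>i<n. B $$ (k, i) * A $$ (i, k))"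
    by (subst sum.swap) (simp add: mult.commute)
  also have "\<dots> = mat_trace (B * A)"
    unfolding mat_trace_def using A B by (simp add: index_mult_mat_sum[OF B A] del: index_mult_mat(1))
  finally show ?thesis .
qed

lemma mat_trace_similar:
  fixes A :: "'a::comm_ring_1 mat"
  assumes "similar_mat_wit A B P Q"
  shows "mat_trace A = mat_trace B"
proof -
  note w = similar_mat_witD[OF refl assms]
  have "mat_trace A = mat_trace (P * (B * Q))"
    by (rule arg_cong[OF trans[OF w(3) assoc_mult_mat[OF w(6,5,7)]]])
  also have "\<dots> = mat_trace (B * Q * P)" by (rule mat_trace_mult_commute[OF w(6) mult_carrier_mat[OF w(5,7)]])
  also have "B * Q * P = B"
    by (simp only: assoc_mult_mat[OF w(5,7,6)] w(2) right_mult_one_mat[OF w(5)])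
  finally show ?thesis .
qed

lemma upper_triangular_mult:
  fixes A :: "'a::semiring_0 mat"
  assumes A: "A \<in> carrier_mat n n" and B: "B \<in> carrier_mat n n"
    and uA: "upper_triangular A" and uB: "upper_triangular B"
  shows "upper_triangular (A * B)"
    and "i < n \<Longrightarrow> (A * B) $$ (i, i) = A $$ (i, i) * B $$ (i, i)"
proof -
  have zA: "A $$ (i, j) = 0" if "j < i" "i < n" for i j using uA A that by auto
  have zB: "B $$ (i, j) = 0" if "j < i" "i < n" for i j using uB B that by auto
  show "upper_triangular (A * B)"
  proof
    fix i j assume "j < i" "i < dim_row (A * B)"
    then have ij: "j < i" "i < n" "j < n" using A by auto
    \<comment> \<open>Either k < i and the entry of \<open>A\<close> vanishes, or j < i \<le> k and
      the entry of \<open>B\<close> does.\<close>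
    have "A $$ (i, k) * B $$ (k, j) = 0" if "k < n" for k
      using that ij zA[of k i] zB[of j k] by (cases "k < i") auto
    then show "(A * B) $$ (i, j) = 0"
      using index_mult_mat_sum[OF A B ij(2,3)] by simp
  qed
  assume i: "i < n"
  have "A $$ (i, k) * B $$ (k, i) = 0" if "k < n" "k \<noteq> i" for k
    using that i zA[of k i] zB[of i k] by (cases "k < i") auto
  then have "(\<Sum>k<n. A $$ (i, k) * B $$ (k, i)) = (\<Sum>k\<in>{i}. A $$ (i, k) * B $$ (k, i))"
    using i by (intro sum.mono_neutral_right) auto
  then show "(A * B) $$ (i, i) = A $$ (i, i) * B $$ (i, i)"
    using index_mult_mat_sum[OF A B i i] by simp
qed

lemma upper_triangular_pow:
  fixes A :: "'a::semiring_1 mat"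
  assumes A: "A \<in> carrier_mat n n" and uA: "upper_triangular A"
  shows "upper_triangular (A ^\<^sub>m k) \<and> (\<forall>i<n. (A ^\<^sub>m k) $$ (i, i) = (A $$ (i, i)) ^ k)"
proof (induction k)
  case 0
  then show ?case using A by simp
next
  case (Suc k)
  then show ?case
    using upper_triangular_mult[OF pow_carrier_mat[OF A, of k] A] uA
    by (simp add: power_commutes)
qed

text \<open>After Schur triangularisation the trace of each power of \<open>M\<close> is the sum of
  that power of the diagonal entries. These are k-th roots of unity, so they have modulus 1 and
  their (k - 1)-st powers are their conjugates.\<close>

lemma mat_trace_finite_order:
  fixes M :: "complex mat"
  assumes M: "M \<in> carrier_mat n n" and k: "k \<ge> 1" and ord: "M ^\<^sub>m k = 1\<^sub>m n"
  shows "mat_trace (M ^\<^sub>m (k - 1)) = cnj (mat_trace M)"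
    and "cmod (mat_trace M) \<le> real n"
proof -
  obtain es where "char_poly M = (\<Prod>a\<leftarrow>es. [:- a, 1:])"
    using char_poly_factorized[OF M] by blast
  then obtain B where B: "B \<in> carrier_mat n n" "upper_triangular B" and "similar_mat M B"
    using schur_decomposition_exists[OF M] by blast
  then obtain P Q where sim: "similar_mat_wit M B P Q" unfolding similar_mat_def by blast
  have tr: "mat_trace (M ^\<^sub>m j) = (\<Sum>i<n. (B $$ (i, i)) ^ j)" for j
    using mat_trace_similar[OF similar_mat_wit_pow[OF sim, of j]] upper_triangular_pow[OF B, of j] B(1)
    by (simp add: mat_trace_def)
  \<comment> \<open>\<open>B ^\<^sub>m k\<close> is similar to \<open>M ^\<^sub>m k\<close>, and
    only the identity is similar to the identity.\<close>
  have "B ^\<^sub>m k = 1\<^sub>m n"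
    using similar_mat_witD[OF refl similar_mat_wit_sym[OF similar_mat_wit_pow[OF sim, of k]]] B(1) ord
      similar_mat_witD2[OF M sim]
    by (metis carrier_matD(1) pow_mat_dim(1) right_mult_one_mat)
  then have e: "(B $$ (i, i)) ^ k = 1" if "i < n" for i
    using that upper_triangular_pow[OF B, of k] by (metis index_one_mat(1))
  have cm: "cmod (B $$ (i, i)) = 1" if "i < n" for i
  proof -
    have "cmod (B $$ (i, i)) ^ k = 1 ^ k" using e[OF that] by (metis norm_one norm_power power_one)
    then show ?thesis using k by (intro power_eq_imp_eq_base[of _ k 1]) auto
  qed
  have "(B $$ (i, i)) ^ (k - 1) = cnj (B $$ (i, i))" if "i < n" for i
  proof -
    let ?b = "B $$ (i, i)"
    have "?b * cnj ?b = 1" using cm[OF that] by (simp add: complex_norm_square[symmetric])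
    moreover have "?b ^ (k - 1) * ?b = 1"
      using e[OF that] k by (cases k) (simp_all add: mult.commute)
    ultimately have "?b ^ (k - 1) * ?b = cnj ?b * ?b" and "?b \<noteq> 0" by (auto simp: mult.commute)
    then show ?thesis by simp
  qed
  then show "mat_trace (M ^\<^sub>m (k - 1)) = cnj (mat_trace M)"
    using tr[of "k - 1"] tr[of 1] M by simp
  have "cmod (mat_trace M) \<le> (\<Sum>i<n. cmod (B $$ (i, i)))"
    using tr[of 1] M norm_sum[of "\<lambda>i. B $$ (i, i)" "{..<n}"] by simp
  then show "cmod (mat_trace M) \<le> real n" using cm by simp
qed

section \<open>Invariant subspaces and irreducibility\<close>

lemma mult_mat_unit_vec:
  fixes A :: "'a::semiring_1 mat"
  assumes "A \<in> carrier_mat n m" "j < m"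
  shows "A *\<^sub>v unit_vec m j = col A j"
  using assms by (intro eq_vecI) auto

lemma mat_eq_0I:
  fixes A :: "'a::semiring_1 mat"
  assumes A: "A \<in> carrier_mat n m" and z: "\<And>v. v \<in> carrier_vec m \<Longrightarrow> A *\<^sub>v v = 0\<^sub>v n"
  shows "A = 0\<^sub>m n m"
proof (rule mat_col_eqI)
  fix j assume "j < dim_col (0\<^sub>m n m)"
  then have "j < m" by simp
  then show "col A j = col (0\<^sub>m n m) j" using mult_mat_unit_vec[OF A, of j] z[of "unit_vec m j"] by simp
qed (use A in auto)

lemma subspace_carrier_vecI:
  assumes "W \<subseteq> carrier_vec n" "0\<^sub>v n \<in> W"
    and "\<And>v w. v \<in> W \<Longrightarrow> w \<in> W \<Longrightarrow> v + w \<in> W" and "\<And>c v. v \<in> W \<Longrightarrow> c \<cdot>\<^sub>v v \<in> W"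
  shows "VectorSpace.subspace class_ring W (module_vec TYPE(complex) n)"
  unfolding VectorSpace.subspace_def LinearCombinations.submodule_def
  using assms by (auto simp: vec_vs vec_module module_vec_simps class_ring_simps)

lemma subspace_smult_closed:
  assumes "VectorSpace.subspace class_ring W (module_vec TYPE(complex) n)" "v \<in> W"
  shows "c \<cdot>\<^sub>v v \<in> W"
  using assms unfolding VectorSpace.subspace_def LinearCombinations.submodule_def
  by (auto simp: module_vec_simps class_ring_simps)

lemma irreducible_representationD:
  assumes "irreducible_representation G n \<rho>"
  shows "representation G n \<rho>" "n \<ge> 1"
    and "\<lbrakk>W \<subseteq> carrier_vec n; 0\<^sub>v n \<in> W; \<And>v w. v \<in> W \<Longrightarrow> w \<in> W \<Longrightarrow> v + w \<in> W;
      \<And>c v. v \<in> W \<Longrightarrow> c \<cdot>\<^sub>v v \<in> W; \<And>g w. g \<in> carrier G \<Longrightarrow> w \<in> W \<Longrightarrow> \<rho> g *\<^sub>v w \<in> W\<rbrakk>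
      \<Longrightarrow> W = {0\<^sub>v n} \<or> W = carrier_vec n"
  using assms subspace_carrier_vecI[of W n] unfolding irreducible_representation_def by blast+

text \<open>Guarantees that the quiver has at least one node.\<close>

lemma trivial_irreducible_representation:
  assumes "group G"
  shows "irreducible_representation G 1 (\<lambda>_. 1\<^sub>m 1)"
  unfolding irreducible_representation_def
proof (intro conjI allI impI)
  show "representation G 1 (\<lambda>_. 1\<^sub>m 1)"
    unfolding representation_def GL_def hom_def units_of_def Units_def ring_mat_def by auto
  fix W assume *: "VectorSpace.subspace class_ring W (module_vec TYPE(complex) 1) \<and>
    (\<forall>g\<in>carrier G. \<forall>w\<in>W. 1\<^sub>m 1 *\<^sub>v w \<in> W)"
  then have W: "W \<subseteq> carrier_vec 1" "0\<^sub>v 1 \<in> W"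
    unfolding VectorSpace.subspace_def LinearCombinations.submodule_def by (auto simp: module_vec_simps)
  show "W = {0\<^sub>v 1} \<or> W = carrier_vec 1"
  proof (cases "W = {0\<^sub>v 1}")
    case False
    then obtain w where w: "w \<in> W" "w \<noteq> 0\<^sub>v 1" using W by blast
    then have w0: "w $ 0 \<noteq> 0" using W by (auto simp: vec_eq_iff)
    have "v \<in> W" if v: "v \<in> carrier_vec 1" for v
    proof -
      have "v = (v $ 0 / w $ 0) \<cdot>\<^sub>v w" using v w w0 W by (intro eq_vecI) auto
      then show ?thesis using subspace_smult_closed[of W 1 w] * w(1) by metis
    qed
    then show ?thesis using W by blast
  qed simp
qed simp

section \<open>Schur's lemma and the orthogonality relations\<close>

context group
begin

lemma representationD:
  assumes "representation G n \<rho>"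
  shows "g \<in> carrier G \<Longrightarrow> \<rho> g \<in> carrier_mat n n"
    and "g \<in> carrier G \<Longrightarrow> h \<in> carrier G \<Longrightarrow> \<rho> (g \<otimes> h) = \<rho> g * \<rho> h"
    and "\<rho> \<one> = 1\<^sub>m n"
    and "g \<in> carrier G \<Longrightarrow> \<rho> (g [^] (k::nat)) = \<rho> g ^\<^sub>m k"
proof -
  \<comment> \<open>Membership in \<open>hom\<close> gives multiplicativity only; preservation of
    the unit comes from \<open>GL n\<close> being a group, the units of the matrix ring.\<close>
  interpret R: ring "ring_mat TYPE(complex) n ()" by (rule ring_mat)
  interpret GL: group "GL n" unfolding GL_def by (rule R.units_group)
  interpret hom: group_hom G "GL n" \<rho>
    using assms unfolding representation_def by unfold_locales
  have GL: "carrier (GL n) \<subseteq> carrier_mat n n" "monoid.mult (GL n) = (*)" "one (GL n) = 1\<^sub>m n"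
    unfolding GL_def units_of_def Units_def ring_mat_def by auto
  show car: "\<rho> g \<in> carrier_mat n n" if "g \<in> carrier G" for g
    using hom.hom_closed[OF that] GL by auto
  show mult: "\<rho> (g \<otimes> h) = \<rho> g * \<rho> h" if "g \<in> carrier G" "h \<in> carrier G" for g h
    using hom.hom_mult[OF that] GL by simp
  show one: "\<rho> \<one> = 1\<^sub>m n" using hom.hom_one GL by simp
  show "\<rho> (g [^] (k::nat)) = \<rho> g ^\<^sub>m k" if "g \<in> carrier G"
    using that car[OF that] by (induction k) (simp_all add: carrier_matD[OF car] one mult GL(2,3))
qed

text \<open>The kernel and the image of an intertwiner are invariant subspaces, hence trivial or
  everything; T \<noteq> 0 rules out the full kernel and the zero image.\<close>

lemma schur_bijective:
  assumes \<rho>: "irreducible_representation G n \<rho>" and \<sigma>: "irreducible_representation G m \<sigma>"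
    and T: "T \<in> carrier_mat n m" and inter: "\<And>g. g \<in> carrier G \<Longrightarrow> \<rho> g * T = T * \<sigma> g"
    and nz: "T \<noteq> 0\<^sub>m n m"
  shows "v \<in> carrier_vec m \<Longrightarrow> T *\<^sub>v v = 0\<^sub>v n \<Longrightarrow> v = 0\<^sub>v m"
    and "w \<in> carrier_vec n \<Longrightarrow> \<exists>v\<in>carrier_vec m. T *\<^sub>v v = w"
proof -
  note \<rho>D = representationD[OF irreducible_representationD(1)[OF \<rho>]]
  note \<sigma>D = representationD[OF irreducible_representationD(1)[OF \<sigma>]]
  have inter_v: "T *\<^sub>v (\<sigma> g *\<^sub>v v) = \<rho> g *\<^sub>v (T *\<^sub>v v)" if "g \<in> carrier G" "v \<in> carrier_vec m" for g v
    using inter[OF that(1)] \<rho>D(1)[OF that(1)] \<sigma>D(1)[OF that(1)] T that(2)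
    by (metis assoc_mult_mat_vec)
  let ?K = "{v \<in> carrier_vec m. T *\<^sub>v v = 0\<^sub>v n}"
  have "?K = {0\<^sub>v m} \<or> ?K = carrier_vec m"
  proof (rule irreducible_representationD(3)[OF \<sigma>])
    fix g w assume "g \<in> carrier G" "w \<in> ?K"
    then show "\<sigma> g *\<^sub>v w \<in> ?K"
      using \<sigma>D(1)[of g] \<rho>D(1)[of g] inter_v[of g w] by auto
  qed (use T in \<open>auto simp: mult_add_distrib_mat_vec[of T n m] mult_mat_vec[of T n m]\<close>)
  moreover have "?K \<noteq> carrier_vec m" using mat_eq_0I[OF T] nz by blast
  ultimately show "v \<in> carrier_vec m \<Longrightarrow> T *\<^sub>v v = 0\<^sub>v n \<Longrightarrow> v = 0\<^sub>v m" by blast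
  let ?I = "(*\<^sub>v) T ` carrier_vec m"
  have "?I = {0\<^sub>v n} \<or> ?I = carrier_vec n"
  proof (rule irreducible_representationD(3)[OF \<rho>])
    show "?I \<subseteq> carrier_vec n" using T by auto
    show "0\<^sub>v n \<in> ?I" using T by (intro image_eqI[of _ _ "0\<^sub>v m"]) auto
    show "v + w \<in> ?I" if "v \<in> ?I" "w \<in> ?I" for v w
      using that T by (auto simp: mult_add_distrib_mat_vec[of T n m, symmetric])
    show "c \<cdot>\<^sub>v v \<in> ?I" if "v \<in> ?I" for c v
      using that T by (auto simp: mult_mat_vec[of T n m, symmetric])
    show "\<rho> g *\<^sub>v w \<in> ?I" if "g \<in> carrier G" "w \<in> ?I" for g w
      using that \<sigma>D(1)[of g] by (auto simp: inter_v[symmetric])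
  qed
  moreover have "?I \<noteq> {0\<^sub>v n}" using mat_eq_0I[OF T] nz by blast
  ultimately have "?I = carrier_vec n" by blast
  then show "w \<in> carrier_vec n \<Longrightarrow> \<exists>v\<in>carrier_vec m. T *\<^sub>v v = w" by (metis imageE)
qed

text \<open>A nonzero intertwiner has a two-sided inverse \<open>S\<close>, so \<rho> g = T
  (\<sigma> g) S, and cyclicity of the trace removes T and S. It works for rectangular T, without
  knowing n = m beforehand.\<close>

lemma schur_trace_eq:
  assumes \<rho>: "irreducible_representation G n \<rho>" and \<sigma>: "irreducible_representation G m \<sigma>"
    and T: "T \<in> carrier_mat n m" and inter: "\<And>g. g \<in> carrier G \<Longrightarrow> \<rho> g * T = T * \<sigma> g"
    and nz: "T \<noteq> 0\<^sub>m n m" and g: "g \<in> carrier G"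
  shows "mat_trace (\<rho> g) = mat_trace (\<sigma> g)"
proof -
  note inj = schur_bijective(1)[OF \<rho> \<sigma> T inter nz] and surj = schur_bijective(2)[OF \<rho> \<sigma> T inter nz]
  have "\<forall>i. \<exists>v\<in>carrier_vec m. i < n \<longrightarrow> T *\<^sub>v v = unit_vec n i"
    using surj by (metis unit_vec_carrier zero_carrier_vec)
  then obtain v where v: "\<And>i. v i \<in> carrier_vec m" "\<And>i. i < n \<Longrightarrow> T *\<^sub>v v i = unit_vec n i"
    by metis
  \<comment> \<open>The columns of the right inverse are preimages of the unit vectors.\<close>
  define S where "S = mat_of_cols m (map v [0..<n])"
  have S: "S \<in> carrier_mat m n" unfolding S_def by (simp add: mat_of_cols_def)
  have colS: "col S i = v i" if "i < n" for i
    using that v(1)[of i] unfolding S_def by (subst col_mat_of_cols) auto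
  have TS: "T * S = 1\<^sub>m n"
  proof (rule mat_col_eqI)
    fix j assume "j < dim_col (1\<^sub>m n)"
    then show "col (T * S) j = col (1\<^sub>m n) j" using col_mult2[OF T S, of j] colS v(2) by simp
  qed (use S T in auto)
  have ST: "S * T = 1\<^sub>m m"
  proof (rule mat_col_eqI)
    fix j assume "j < dim_col (1\<^sub>m m)"
    then have j: "j < m" by simp
    have c: "col (S * T) j \<in> carrier_vec m" using col_dim[of "S * T" j] S by simp
    \<comment> \<open>From T S = 1 one gets T (S T) = T, and injectivity of T cancels it on the
      left, column by column.\<close>
    have "T *\<^sub>v col (S * T) j = col (T * (S * T)) j"
      using col_mult2[OF T mult_carrier_mat[OF S T] j] by simp
    also have "T * (S * T) = T" using assoc_mult_mat[OF T S T] TS T by simp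
    also have "col T j = T *\<^sub>v unit_vec m j" using mult_mat_unit_vec[OF T j] by simp
    finally have eq: "T *\<^sub>v col (S * T) j = T *\<^sub>v unit_vec m j" .
    have diff: "T *\<^sub>v (col (S * T) j - unit_vec m j) = 0\<^sub>v n"
      unfolding mult_minus_distrib_mat_vec[OF T c unit_vec_carrier] eq
      by (rule minus_cancel_vec[OF mult_mat_vec_carrier[OF T unit_vec_carrier]])
    have z: "col (S * T) j - unit_vec m j = 0\<^sub>v m"
      by (rule inj[OF _ minus_carrier_vec[OF c unit_vec_carrier] diff])
    have "col (S * T) j $ i = unit_vec m j $ i" if "i < m" for i
      using arg_cong[OF z, of "\<lambda>v. v $ i"] that c by simp
    then have "col (S * T) j = unit_vec m j" using c by (intro eq_vecI) (simp_all only: carrier_vecD index_unit_vec(3))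
    then show "col (S * T) j = col (1\<^sub>m m) j" using j by simp
  qed (use S T in auto)
  note \<rho>g = representationD(1)[OF irreducible_representationD(1)[OF \<rho>] g]
  note \<sigma>g = representationD(1)[OF irreducible_representationD(1)[OF \<sigma>] g]
  have "\<rho> g = \<rho> g * T * S" using assoc_mult_mat[OF \<rho>g T S] TS \<rho>g by simp
  then have "mat_trace (\<rho> g) = mat_trace (T * (\<sigma> g * S))"
    using inter[OF g] assoc_mult_mat[OF T \<sigma>g S] by simp
  also have "\<dots> = mat_trace (\<sigma> g * S * T)" by (rule mat_trace_mult_commute[OF T]) (use \<sigma>g S in auto)
  also have "\<sigma> g * S * T = \<sigma> g" using assoc_mult_mat[OF \<sigma>g S T] ST \<sigma>g by simp
  finally show ?thesis .
qed

text \<open>Over the complex numbers T has an eigenvalue c; then T - c 1 is an intertwiner killing a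
  nonzero vector, hence zero.\<close>

lemma schur_scalar:
  assumes \<rho>: "irreducible_representation G n \<rho>"
    and T: "T \<in> carrier_mat n n" and inter: "\<And>g. g \<in> carrier G \<Longrightarrow> \<rho> g * T = T * \<rho> g"
  shows "\<exists>c. T = c \<cdot>\<^sub>m 1\<^sub>m n"
proof -
  have "n > 0" using irreducible_representationD(2)[OF \<rho>] by simp
  then obtain c where "eigenvalue T c" using spectrum_non_empty[OF T] unfolding spectrum_def by auto
  then obtain v where v: "v \<in> carrier_vec n" "v \<noteq> 0\<^sub>v n" "T *\<^sub>v v = c \<cdot>\<^sub>v v"
    using T unfolding eigenvalue_def eigenvector_def by auto
  define X where "X = T - c \<cdot>\<^sub>m 1\<^sub>m n"
  have X: "X \<in> carrier_mat n n" using T unfolding X_def by auto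
  have "\<rho> g * X = X * \<rho> g" if g: "g \<in> carrier G" for g
  proof -
    have r: "\<rho> g \<in> carrier_mat n n"
      using representationD(1)[OF irreducible_representationD(1)[OF \<rho>] g] .
    have "\<rho> g * (c \<cdot>\<^sub>m 1\<^sub>m n) = (c \<cdot>\<^sub>m 1\<^sub>m n) * \<rho> g"
      by (simp only: mult_smult_distrib[OF r one_carrier_mat] mult_smult_assoc_mat[OF one_carrier_mat r]
          left_mult_one_mat[OF r] right_mult_one_mat[OF r])
    then show ?thesis unfolding X_def using r T inter[OF g]
      by (simp add: mult_minus_distrib_mat[of _ n n] minus_mult_distrib_mat[of _ n n])
  qed
  moreover have "X *\<^sub>v v = 0\<^sub>v n"
  proof -
    have "(c \<cdot>\<^sub>m 1\<^sub>m n) *\<^sub>v v = c \<cdot>\<^sub>v v" using v(1) by (intro eq_vecI) (auto simp: row_smult)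
    then show ?thesis unfolding X_def using T v by (simp add: minus_mult_distrib_mat_vec[of _ n n])
  qed
  ultimately have "X = 0\<^sub>m n n" using schur_bijective(1)[OF \<rho> \<rho> X] v(1,2) by blast
  then have "T $$ (i, j) = (c \<cdot>\<^sub>m 1\<^sub>m n) $$ (i, j)" if "i < n" "j < n" for i j
  proof -
    have "X $$ (i, j) = 0" using \<open>X = 0\<^sub>m n n\<close> that by simp
    then show ?thesis using that T unfolding X_def by simp
  qed
  then have "T = c \<cdot>\<^sub>m 1\<^sub>m n" using T by (intro eq_matI) auto
  then show ?thesis ..
qed

text \<open>Entrywise form of the unnormalised average of \<rho>(g) E \<sigma>(g^-1) over the group,
  where E is the matrix unit at position (k, l).\<close>

definition average_mat :: "nat \<Rightarrow> nat \<Rightarrow> ('a \<Rightarrow> complex mat) \<Rightarrow> ('a \<Rightarrow> complex mat) \<Rightarrow> nat \<Rightarrow> nat \<Rightarrow> complex mat" where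
  "average_mat n m \<rho> \<sigma> k l =
    mat n m (\<lambda>(i, j). \<Sum>g\<in>carrier G. \<rho> g $$ (i, k) * \<sigma> (inv g) $$ (l, j))"

lemma average_mat_intertwines:
  assumes \<rho>: "representation G n \<rho>" and \<sigma>: "representation G m \<sigma>"
    and kl: "k < n" "l < m" and h: "h \<in> carrier G"
  shows "\<rho> h * average_mat n m \<rho> \<sigma> k l = average_mat n m \<rho> \<sigma> k l * \<sigma> h"
proof (rule eq_matI)
  note \<rho>D = representationD[OF \<rho>] and \<sigma>D = representationD[OF \<sigma>]
  let ?T = "average_mat n m \<rho> \<sigma> k l"
  have T: "?T \<in> carrier_mat n m" unfolding average_mat_def by simp
  show "dim_row (\<rho> h * ?T) = dim_row (?T * \<sigma> h)" "dim_col (\<rho> h * ?T) = dim_col (?T * \<sigma> h)"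
    using T \<rho>D(1)[OF h] \<sigma>D(1)[OF h] by auto
  fix i j assume "i < dim_row (?T * \<sigma> h)" "j < dim_col (?T * \<sigma> h)"
  then have ij: "i < n" "j < m" using T \<sigma>D(1)[OF h] by auto
  have "(\<rho> h * ?T) $$ (i, j) =
      (\<Sum>a<n. \<rho> h $$ (i, a) * (\<Sum>g\<in>carrier G. \<rho> g $$ (a, k) * \<sigma> (inv g) $$ (l, j)))"
    unfolding index_mult_mat_sum[OF \<rho>D(1)[OF h] T ij] by (simp add: average_mat_def ij)
  also have "\<dots> = (\<Sum>g\<in>carrier G. (\<Sum>a<n. \<rho> h $$ (i, a) * \<rho> g $$ (a, k)) * \<sigma> (inv g) $$ (l, j))"
    by (subst sum_prod_swap) (simp add: sum_distrib_right mult.assoc)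
  \<comment> \<open>The inverse of g is rewritten through h g, so that the summand depends on h g
    alone and left translation can reindex the sum.\<close>
  also have "\<dots> = (\<Sum>g\<in>carrier G. \<rho> (h \<otimes> g) $$ (i, k) * \<sigma> (inv (h \<otimes> g) \<otimes> h) $$ (l, j))"
  proof (rule sum.cong[OF refl])
    fix g assume g: "g \<in> carrier G"
    have "inv (h \<otimes> g) \<otimes> h = inv g" using g h by (simp add: inv_mult_group m_assoc)
    then show "(\<Sum>a<n. \<rho> h $$ (i, a) * \<rho> g $$ (a, k)) * \<sigma> (inv g) $$ (l, j) =
        \<rho> (h \<otimes> g) $$ (i, k) * \<sigma> (inv (h \<otimes> g) \<otimes> h) $$ (l, j)"
      using index_mult_mat_sum[OF \<rho>D(1)[OF h] \<rho>D(1)[OF g] ij(1) kl(1)] \<rho>D(2)[OF h g] by simp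
  qed
  also have "\<dots> = (\<Sum>g\<in>carrier G. \<rho> g $$ (i, k) * \<sigma> (inv g \<otimes> h) $$ (l, j))"
    by (rule sum.reindex_bij_betw[OF bij_betw_imageI[OF inj_on_cmult[OF h] surj_const_mult[OF h]]])
  also have "\<dots> = (\<Sum>g\<in>carrier G. \<Sum>b<m. \<rho> g $$ (i, k) * (\<sigma> (inv g) $$ (l, b) * \<sigma> h $$ (b, j)))"
  proof (rule sum.cong[OF refl])
    fix g assume g: "g \<in> carrier G"
    show "\<rho> g $$ (i, k) * \<sigma> (inv g \<otimes> h) $$ (l, j) =
        (\<Sum>b<m. \<rho> g $$ (i, k) * (\<sigma> (inv g) $$ (l, b) * \<sigma> h $$ (b, j)))"
      using index_mult_mat_sum[OF \<sigma>D(1) \<sigma>D(1)[OF h] kl(2) ij(2), of "inv g"] \<sigma>D(2)[of "inv g" h] g h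
      by (simp add: sum_distrib_left)
  qed
  also have "\<dots> = (\<Sum>b<m. (\<Sum>g\<in>carrier G. \<rho> g $$ (i, k) * \<sigma> (inv g) $$ (l, b)) * \<sigma> h $$ (b, j))"
    by (subst sum.swap) (simp add: sum_distrib_right mult.assoc)
  also have "\<dots> = (?T * \<sigma> h) $$ (i, j)"
    unfolding index_mult_mat_sum[OF T \<sigma>D(1)[OF h] ij] by (simp add: average_mat_def ij)
  finally show "(\<rho> h * ?T) $$ (i, j) = (?T * \<sigma> h) $$ (i, j)" .
qed

text \<open>Expanding both traces along the diagonal expresses the inner product of characters by
  entries of intertwiners, to which Schur's lemma applies.\<close>

lemma trace_inner_product_average:
  assumes \<rho>: "representation G n \<rho>" and \<sigma>: "representation G m \<sigma>"
  shows "(\<Sum>g\<in>carrier G. mat_trace (\<rho> g) * mat_trace (\<sigma> (inv g))) =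
    (\<Sum>i<n. \<Sum>l<m. average_mat n m \<rho> \<sigma> i l $$ (i, l))"
proof -
  note \<rho>D = representationD[OF \<rho>] and \<sigma>D = representationD[OF \<sigma>]
  have "(\<Sum>g\<in>carrier G. mat_trace (\<rho> g) * mat_trace (\<sigma> (inv g))) =
      (\<Sum>g\<in>carrier G. \<Sum>i<n. \<Sum>l<m. \<rho> g $$ (i, i) * \<sigma> (inv g) $$ (l, l))"
    by (intro sum.cong refl)
      (simp add: mat_trace_def sum_product carrier_matD(1)[OF \<rho>D(1)] carrier_matD(1)[OF \<sigma>D(1)])
  also have "\<dots> = (\<Sum>i<n. \<Sum>l<m. \<Sum>g\<in>carrier G. \<rho> g $$ (i, i) * \<sigma> (inv g) $$ (l, l))"
    by (subst sum.swap, rule sum.cong[OF refl], subst sum.swap) simp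
  finally show ?thesis by (simp add: average_mat_def)
qed

text \<open>A nonzero average would be an intertwiner forcing equal traces everywhere. Inequivalence
  is expressed by the traces because the nodes are labelled by distinct characters.\<close>

lemma trace_orthogonal:
  assumes \<rho>: "irreducible_representation G n \<rho>" and \<sigma>: "irreducible_representation G m \<sigma>"
    and neq: "h \<in> carrier G" "mat_trace (\<rho> h) \<noteq> mat_trace (\<sigma> h)"
  shows "(\<Sum>g\<in>carrier G. mat_trace (\<rho> g) * mat_trace (\<sigma> (inv g))) = 0"
proof -
  note \<rho>' = irreducible_representationD(1)[OF \<rho>] and \<sigma>' = irreducible_representationD(1)[OF \<sigma>]
  have "average_mat n m \<rho> \<sigma> k l = 0\<^sub>m n m" if "k < n" "l < m" for k l
    using schur_trace_eq[OF \<rho> \<sigma> _ average_mat_intertwines[OF \<rho>' \<sigma>' that] _ neq(1)] neq(2)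
    by (fastforce simp: average_mat_def)
  then show ?thesis unfolding trace_inner_product_average[OF \<rho>' \<sigma>'] by simp
qed

lemma trace_normalised:
  assumes \<rho>: "irreducible_representation G n \<rho>"
  shows "(\<Sum>g\<in>carrier G. mat_trace (\<rho> g) * mat_trace (\<rho> (inv g))) = of_nat (card (carrier G))"
proof -
  note \<rho>' = irreducible_representationD(1)[OF \<rho>]
  note \<rho>D = representationD[OF \<rho>']
  let ?T = "average_mat n n \<rho> \<rho>" and ?N = "of_nat (card (carrier G)) :: complex"
  have n: "n \<ge> 1" using irreducible_representationD(2)[OF \<rho>] .
  \<comment> \<open>The average is a scalar matrix c 1; taking its trace and using \<rho>(g^-1)
    \<rho>(g) = 1 evaluates n c.\<close>
  have diag: "of_nat n * ?T k l $$ (k, l) = (if k = l then ?N else 0)" if kl: "k < n" "l < n" for k l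
  proof -
    have T: "?T k l \<in> carrier_mat n n" by (simp add: average_mat_def)
    obtain c where c: "?T k l = c \<cdot>\<^sub>m 1\<^sub>m n"
      using schur_scalar[OF \<rho> T average_mat_intertwines[OF \<rho>' \<rho>' kl]] by blast
    have "of_nat n * c = (\<Sum>i<n. ?T k l $$ (i, i))" unfolding c by simp
    also have "\<dots> = (\<Sum>i<n. \<Sum>g\<in>carrier G. \<rho> g $$ (i, k) * \<rho> (inv g) $$ (l, i))"
      by (simp add: average_mat_def)
    also have "\<dots> = (\<Sum>g\<in>carrier G. \<Sum>i<n. \<rho> (inv g) $$ (l, i) * \<rho> g $$ (i, k))"
      by (subst sum.swap) (simp add: mult.commute)
    also have "\<dots> = (\<Sum>g\<in>carrier G. (1\<^sub>m n :: complex mat) $$ (l, k))"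
    proof (rule sum.cong[OF refl])
      fix g assume g: "g \<in> carrier G"
      then have "\<rho> (inv g) * \<rho> g = 1\<^sub>m n" using \<rho>D(2)[of "inv g" g] \<rho>D(3) by simp
      then show "(\<Sum>i<n. \<rho> (inv g) $$ (l, i) * \<rho> g $$ (i, k)) = (1\<^sub>m n :: complex mat) $$ (l, k)"
        using index_mult_mat_sum[OF \<rho>D(1) \<rho>D(1) kl(2,1), of "inv g" g] g by simp
    qed
    also have "\<dots> = (if k = l then ?N else 0)" using kl by simp
    finally show ?thesis unfolding c using kl by auto
  qed
  have "of_nat n * (\<Sum>g\<in>carrier G. mat_trace (\<rho> g) * mat_trace (\<rho> (inv g))) =
      (\<Sum>i<n. \<Sum>l<n. of_nat n * ?T i l $$ (i, l))"
    unfolding trace_inner_product_average[OF \<rho>' \<rho>'] by (simp add: sum_distrib_left)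
  also have "\<dots> = (\<Sum>i<n. \<Sum>l<n. if i = l then ?N else 0)"
    using diag by (intro sum.cong) auto
  also have "\<dots> = of_nat n * ?N" by simp
  finally show ?thesis using n by simp
qed

text \<open>By Lagrange g^k = 1 for the group order k, so \<rho> g has finite order and g^-1 =
  g^(k-1).\<close>

lemma trace_representation_finite_group:
  assumes \<rho>: "representation G n \<rho>" and fin: "finite (carrier G)" and g: "g \<in> carrier G"
  shows "mat_trace (\<rho> (inv g)) = cnj (mat_trace (\<rho> g))"
    and "cmod (mat_trace (\<rho> g)) \<le> real n"
proof -
  note \<rho>D = representationD[OF \<rho>]
  define k where "k = card (carrier G)"
  have k: "k \<ge> 1" unfolding k_def using fin by (metis One_nat_def Suc_leI card_gt_0_iff carrier_not_empty)
  have gk: "g [^] k = \<one>" unfolding k_def using pow_order_eq_1[OF g] by (simp add: Coset.order_def)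
  then have "g [^] (k - 1) \<otimes> g = \<one>" using k g by (cases k) auto
  then have "inv g = g [^] (k - 1)" using g by (metis inv_equality nat_pow_closed)
  then have inv: "\<rho> (inv g) = \<rho> g ^\<^sub>m (k - 1)" using \<rho>D(4)[OF g] by simp
  have "\<rho> g ^\<^sub>m k = 1\<^sub>m n" using \<rho>D(4)[OF g, of k] \<rho>D(3) gk by simp
  from mat_trace_finite_order[OF \<rho>D(1)[OF g] k this]
  show "mat_trace (\<rho> (inv g)) = cnj (mat_trace (\<rho> g))" "cmod (mat_trace (\<rho> g)) \<le> real n"
    unfolding inv by auto
qed

end

section \<open>Orbifold quivers\<close>

text \<open>Left inverses come from finiteness: right multiplication by g is injective on \<Gamma>,
  being undone by the adjoint of g, hence surjective, so it reaches the identity.\<close>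

lemma group_of_subgroup_SU3:
  assumes sub: "subgroup \<Gamma> SU3" and fin: "finite \<Gamma>"
  shows "group (SU3\<lparr>carrier := \<Gamma>\<rparr>)"
proof -
  have car: "\<Gamma> \<subseteq> carrier_mat 3 3" and unit: "\<And>g. g \<in> \<Gamma> \<Longrightarrow> g * mat_adjoint g = 1\<^sub>m 3"
    using subgroup.subset[OF sub] by (auto simp: SU3_def)
  have mult: "g * h \<in> \<Gamma>" if "g \<in> \<Gamma>" "h \<in> \<Gamma>" for g h
    using subgroup.m_closed[OF sub that] by (simp add: SU3_def)
  have one: "1\<^sub>m 3 \<in> \<Gamma>" using subgroup.one_closed[OF sub] by (simp add: SU3_def)
  have adj: "mat_adjoint g \<in> carrier_mat 3 3" if "g \<in> \<Gamma>" for g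
    using that car by (force simp: mat_adjoint_def)
  have "\<exists>y\<in>\<Gamma>. y * g = 1\<^sub>m 3" if g: "g \<in> \<Gamma>" for g
  proof -
    have "inj_on (\<lambda>y. y * g) \<Gamma>"
    proof (rule inj_on_inverseI[where g = "\<lambda>z. z * mat_adjoint g"])
      fix y assume "y \<in> \<Gamma>"
      then have y: "y \<in> carrier_mat 3 3" and g': "g \<in> carrier_mat 3 3" using car g by auto
      show "y * g * mat_adjoint g = y"
        using assoc_mult_mat[OF y g' adj[OF g]] unit[OF g] y by simp
    qed
    then have "(\<lambda>y. y * g) ` \<Gamma> = \<Gamma>"
      using mult g fin by (intro endo_inj_surj) auto
    then show ?thesis using one by (metis imageE)
  qed
  then show ?thesis
    using mult one car
    by (intro groupI) (auto simp: SU3_def subset_iff assoc_mult_mat[of _ 3 3 _ 3 _ 3])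
qed

lemma symmetrised_carrier:
  assumes "A \<in> carrier_mat r r"
  shows "symmetrised A \<in> carrier_mat r r" "transpose_mat (symmetrised A) = symmetrised A"
  using assms unfolding symmetrised_def by (auto intro!: eq_matI)

text \<open>The antisymmetric part of \<open>A\<close> drops out of the form, so the character
  relation, which concerns \<open>A\<close> itself, can be used.\<close>

lemma symmetrised_quadratic_form:
  assumes A: "A \<in> carrier_mat r r" and p: "p \<in> carrier_vec r"
  shows "p \<bullet> (symmetrised A *\<^sub>v p) = (\<Sum>i<r. \<Sum>j<r. real (A $$ (i, j)) * p $ i * p $ j)"
proof -
  let ?q = "\<lambda>i j. real (A $$ (i, j)) * p $ i * p $ j"
  have "p \<bullet> (symmetrised A *\<^sub>v p) = (\<Sum>i<r. \<Sum>j<r. (?q i j + ?q j i) / 2)"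
    using A p unfolding symmetrised_def
    by (simp add: scalar_prod_def sum_distrib_left lessThan_atLeast0)
      (intro sum.cong refl, simp add: field_simps)
  also have "\<dots> = ((\<Sum>i<r. \<Sum>j<r. ?q i j) + (\<Sum>i<r. \<Sum>j<r. ?q j i)) / 2"
    by (simp only: sum_divide_distrib[symmetric] sum.distrib)
  also have "(\<Sum>i<r. \<Sum>j<r. ?q j i) = (\<Sum>i<r. \<Sum>j<r. ?q i j)" by (rule sum.swap)
  finally show ?thesis by simp
qed

lemma quiver_max_rayleigh:
  assumes sub: "subgroup \<Gamma> SU3" and fin: "finite \<Gamma>"
    and bij: "bij_betw \<chi> {..<r} (irreducible_characters (SU3\<lparr>carrier := \<Gamma>\<rparr>))"
    and quiver: "quiver_adjacency \<Gamma> r \<chi> A"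
  shows "max_rayleigh r (symmetrised A) 3" and "r \<ge> 1"
proof -
  define G where "G = SU3\<lparr>carrier := \<Gamma>\<rparr>"
  have carG: "carrier G = \<Gamma>" and oneG: "one G = 1\<^sub>m 3" and multG: "monoid.mult G = (*)"
    by (simp_all add: G_def SU3_def)
  interpret G: group G unfolding G_def by (rule group_of_subgroup_SU3[OF sub fin])
  have finG: "finite (carrier G)" using fin carG by simp
  have car: "\<Gamma> \<subseteq> carrier_mat 3 3" using subgroup.subset[OF sub] by (auto simp: SU3_def)
  have one: "1\<^sub>m 3 \<in> \<Gamma>" using G.one_closed carG oneG by simp
  define N where "N = real (card \<Gamma>)"
  have N: "N > 0" unfolding N_def using one fin by (auto simp: card_gt_0_iff)
  have A: "A \<in> carrier_mat r r"
    and adj: "\<And>g i. g \<in> \<Gamma> \<Longrightarrow> i < r \<Longrightarrow> mat_trace g * \<chi> i g = (\<Sum>j<r. of_nat (A $$ (i, j)) * \<chi> j g)"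
    using quiver unfolding quiver_adjacency_def by auto

  have "restrict (\<lambda>g. mat_trace (1\<^sub>m 1 :: complex mat)) \<Gamma> \<in> irreducible_characters G"
    unfolding irreducible_characters_def carG mem_Collect_eq
    by (intro exI conjI, rule refl, rule trivial_irreducible_representation[OF G.is_group])
  then show r: "r \<ge> 1"
    using bij unfolding G_def bij_betw_def by (cases "r = 0") auto

  have "\<forall>i. \<exists>n \<rho>. i < r \<longrightarrow> irreducible_representation G n \<rho> \<and> \<chi> i = restrict (\<lambda>g. mat_trace (\<rho> g)) \<Gamma>"
  proof
    fix i
    show "\<exists>n \<rho>. i < r \<longrightarrow> irreducible_representation G n \<rho> \<and> \<chi> i = restrict (\<lambda>g. mat_trace (\<rho> g)) \<Gamma>"
    proof (cases "i < r")
      case True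
      then have "\<chi> i \<in> irreducible_characters G"
        using bij unfolding G_def by (auto simp: bij_betw_def)
      then show ?thesis unfolding irreducible_characters_def carG by auto
    qed simp
  qed
  then obtain n R where R: "\<And>i. i < r \<Longrightarrow> irreducible_representation G (n i) (R i)"
    and \<chi>R: "\<And>i. i < r \<Longrightarrow> \<chi> i = restrict (\<lambda>g. mat_trace (R i g)) \<Gamma>"
    by metis
  have rep: "representation G (n i) (R i)" if "i < r" for i
    using irreducible_representationD(1)[OF R[OF that]] .
  have \<chi>: "\<chi> i g = mat_trace (R i g)" if "i < r" "g \<in> \<Gamma>" for i g
    using \<chi>R that by simp
  have inj: "inj_on \<chi> {..<r}" using bij by (rule bij_betw_imp_inj_on)

  have orth: "(\<Sum>g\<in>\<Gamma>. \<chi> i g * cnj (\<chi> k g)) = (if i = k then of_real N else 0)"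
    if ik: "i < r" "k < r" for i k
  proof -
    have "(\<Sum>g\<in>\<Gamma>. \<chi> i g * cnj (\<chi> k g)) =
        (\<Sum>g\<in>carrier G. mat_trace (R i g) * mat_trace (R k (inv\<^bsub>G\<^esub> g)))"
      unfolding carG
    proof (rule sum.cong[OF refl])
      fix g assume g: "g \<in> \<Gamma>"
      show "\<chi> i g * cnj (\<chi> k g) = mat_trace (R i g) * mat_trace (R k (inv\<^bsub>G\<^esub> g))"
        using G.trace_representation_finite_group(1)[OF rep[OF ik(2)] finG, of g] g
        by (simp add: \<chi>[OF ik(1) g] \<chi>[OF ik(2) g] carG)
    qed
    also have "\<dots> = (if i = k then of_real N else 0)"
    proof (cases "i = k")
      case True
      then show ?thesis using G.trace_normalised[OF R[OF ik(1)]] by (simp add: N_def carG)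
    next
      case False
      then have "\<chi> i \<noteq> \<chi> k" using inj ik by (auto dest: inj_onD)
      \<comment> \<open>Characters are restricted to \<Gamma>, so different ones already differ at
        some element of \<Gamma>.\<close>
      moreover have "\<chi> i = \<chi> k" if "\<And>h. h \<in> \<Gamma> \<Longrightarrow> mat_trace (R i h) = mat_trace (R k h)"
        unfolding \<chi>R[OF ik(1)] \<chi>R[OF ik(2)] by (rule restrict_ext) (rule that)
      ultimately obtain h where "h \<in> \<Gamma>" "mat_trace (R i h) \<noteq> mat_trace (R k h)" by blast
      then show ?thesis
        using G.trace_orthogonal[OF R[OF ik(1)] R[OF ik(2)], of h] carG False by simp
    qed
    finally show ?thesis .
  qed
  \<comment> \<open>Used twice: with a = p for the norm of f, and with a = A^T p for the quadratic
    form. Real p passes unchanged through the conjugation.\<close>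
  have parseval: "(\<Sum>g\<in>\<Gamma>. (\<Sum>i<r. a i * \<chi> i g) * cnj (\<Sum>k<r. of_real (p k) * \<chi> k g)) =
      of_real N * (\<Sum>k<r. a k * of_real (p k))" for a :: "nat \<Rightarrow> complex" and p :: "nat \<Rightarrow> real"
  proof -
    have "(\<Sum>g\<in>\<Gamma>. (\<Sum>i<r. a i * \<chi> i g) * cnj (\<Sum>k<r. of_real (p k) * \<chi> k g)) =
        (\<Sum>g\<in>\<Gamma>. \<Sum>i<r. \<Sum>k<r. a i * of_real (p k) * (\<chi> i g * cnj (\<chi> k g)))"
      by (simp add: sum_product mult_ac)
    also have "\<dots> = (\<Sum>i<r. \<Sum>k<r. a i * of_real (p k) * (\<Sum>g\<in>\<Gamma>. \<chi> i g * cnj (\<chi> k g)))"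
      by (subst sum.swap, rule sum.cong[OF refl], subst sum.swap) (simp add: sum_distrib_left)
    also have "\<dots> = (\<Sum>i<r. \<Sum>k<r. if i = k then a i * of_real (p k) * of_real N else 0)"
      by (intro sum.cong refl) (simp add: orth)
    also have "\<dots> = of_real N * (\<Sum>k<r. a k * of_real (p k))"
      by (simp add: sum_distrib_left mult_ac)
    finally show ?thesis .
  qed

  \<comment> \<open>The inclusion of \<Gamma> is a representation of dimension 3, which yields the
    bound 3 on the traces.\<close>
  have "representation G 3 (\<lambda>g. g)"
  proof -
    have "g \<in> Units (ring_mat TYPE(complex) 3 ())" if g: "g \<in> \<Gamma>" for g
    proof -
      have "inv\<^bsub>G\<^esub> g \<in> \<Gamma>" "inv\<^bsub>G\<^esub> g * g = 1\<^sub>m 3" "g * inv\<^bsub>G\<^esub> g = 1\<^sub>m 3"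
        using G.inv_closed[of g] G.l_inv[of g] G.r_inv[of g] g carG oneG multG by auto
      then show ?thesis using g car unfolding Units_def by (auto simp: ring_mat_simps)
    qed
    then show ?thesis
      unfolding representation_def hom_def GL_def units_of_def
      by (auto simp: carG multG ring_mat_simps)
  qed
  then have bound: "cmod (mat_trace g) \<le> 3" if "g \<in> \<Gamma>" for g
    using G.trace_representation_finite_group(2)[OF _ finG, of 3 "\<lambda>g. g" g] that carG by simp

  show "max_rayleigh r (symmetrised A) 3"
    unfolding max_rayleigh_def
  proof (intro conjI ballI symmetrised_carrier[OF A])
    fix p :: "real vec" assume p: "p \<in> carrier_vec r"
    define f where "f g = (\<Sum>k<r. of_real (p $ k) * \<chi> k g)" for g
    have "(\<Sum>g\<in>\<Gamma>. f g * cnj (f g)) = of_real N * (\<Sum>k<r. of_real (p $ k) * of_real (p $ k))"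
      unfolding f_def by (rule parseval)
    also have "\<dots> = of_real (N * (p \<bullet> p))"
      using p by (simp add: scalar_prod_def lessThan_atLeast0)
    finally have ff: "(\<Sum>g\<in>\<Gamma>. (cmod (f g))\<^sup>2) = N * (p \<bullet> p)"
      by (simp only: complex_norm_square[symmetric] of_real_sum[symmetric] of_real_eq_iff)
    \<comment> \<open>The coefficients of g \<mapsto> tr g * f g with respect to the irreducible
      characters.\<close>
    define a where "a j = (\<Sum>i<r. of_real (p $ i) * of_nat (A $$ (i, j)) :: complex)" for j
    have tf: "mat_trace g * f g = (\<Sum>j<r. a j * \<chi> j g)" if g: "g \<in> \<Gamma>" for g
    proof -
      have "mat_trace g * f g = (\<Sum>i<r. of_real (p $ i) * (mat_trace g * \<chi> i g))"
        unfolding f_def by (simp add: sum_distrib_left mult_ac)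
      also have "\<dots> = (\<Sum>i<r. \<Sum>j<r. of_real (p $ i) * of_nat (A $$ (i, j)) * \<chi> j g)"
        by (intro sum.cong refl) (simp add: adj[OF g] sum_distrib_left mult.assoc)
      also have "\<dots> = (\<Sum>j<r. a j * \<chi> j g)"
        unfolding a_def by (subst sum.swap) (simp add: sum_distrib_right)
      finally show ?thesis .
    qed
    have "(\<Sum>g\<in>\<Gamma>. mat_trace g * f g * cnj (f g)) = (\<Sum>g\<in>\<Gamma>. (\<Sum>j<r. a j * \<chi> j g) * cnj (f g))"
      by (rule sum.cong) (simp_all add: tf)
    also have "\<dots> = of_real N * (\<Sum>k<r. a k * of_real (p $ k))"
      unfolding f_def by (rule parseval)
    also have "(\<Sum>k<r. a k * of_real (p $ k)) = of_real (\<Sum>k<r. \<Sum>i<r. real (A $$ (i, k)) * p $ i * p $ k)"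
      unfolding a_def by (simp add: sum_distrib_left mult_ac)
    also have "(\<Sum>k<r. \<Sum>i<r. real (A $$ (i, k)) * p $ i * p $ k) = p \<bullet> (symmetrised A *\<^sub>v p)"
      unfolding symmetrised_quadratic_form[OF A p] by (rule sum.swap)
    finally have "(\<Sum>g\<in>\<Gamma>. mat_trace g * f g * cnj (f g)) = of_real (N * (p \<bullet> (symmetrised A *\<^sub>v p)))"
      by simp
    then have "N * (p \<bullet> (symmetrised A *\<^sub>v p)) \<le> cmod (\<Sum>g\<in>\<Gamma>. mat_trace g * f g * cnj (f g))"
      by (simp only: norm_of_real abs_ge_self)
    also have "\<dots> \<le> (\<Sum>g\<in>\<Gamma>. cmod (mat_trace g) * (cmod (f g))\<^sup>2)"
      by (rule order_trans[OF norm_sum]) (simp add: norm_mult power2_eq_square mult.assoc)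
    also have "\<dots> \<le> (\<Sum>g\<in>\<Gamma>. 3 * (cmod (f g))\<^sup>2)"
      by (intro sum_mono mult_right_mono bound) auto
    also have "\<dots> = N * (3 * (p \<bullet> p))" unfolding sum_distrib_left[symmetric] ff by simp
    finally show "p \<bullet> (symmetrised A *\<^sub>v p) \<le> 3 * (p \<bullet> p)" using N by simp
  next
    have tr1: "mat_trace (1\<^sub>m k :: complex mat) = of_nat k" for k by (simp add: mat_trace_def)
    have \<chi>1: "\<chi> i (1\<^sub>m 3) = of_nat (n i)" if "i < r" for i
      using \<chi>[OF that one] G.representationD(3)[OF rep[OF that]] oneG tr1 by simp
    \<comment> \<open>The adjacency relation at the identity: since \<chi>_i(1) = n_i and tr 1 = 3,
      the vector of dimensions satisfies A n = 3 n.\<close>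
    have dim: "(\<Sum>j<r. real (A $$ (i, j)) * real (n j)) = 3 * real (n i)" if i: "i < r" for i
    proof -
      have "(of_nat (\<Sum>j<r. A $$ (i, j) * n j) :: complex) = of_nat (3 * n i)"
        using adj[OF one i] \<chi>1 i by (simp add: tr1)
      then have "(\<Sum>j<r. A $$ (i, j) * n j) = 3 * n i" by (simp only: of_nat_eq_iff)
      then have "real (\<Sum>j<r. A $$ (i, j) * n j) = real (3 * n i)" by simp
      then show ?thesis by simp
    qed
    show "\<exists>p\<in>carrier_vec r. p \<noteq> 0\<^sub>v r \<and> p \<bullet> (symmetrised A *\<^sub>v p) = 3 * (p \<bullet> p)"
    proof (intro bexI conjI)
      let ?d = "vec r (\<lambda>i. real (n i))"
      show d: "?d \<in> carrier_vec r" by simp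
      have "n 0 \<ge> 1" using irreducible_representationD(2)[OF R[of 0]] r by simp
      then show "?d \<noteq> 0\<^sub>v r" using r by (auto simp: vec_eq_iff intro!: exI[of _ 0])
      have "?d \<bullet> (symmetrised A *\<^sub>v ?d) = (\<Sum>i<r. real (n i) * (\<Sum>j<r. real (A $$ (i, j)) * real (n j)))"
        unfolding symmetrised_quadratic_form[OF A d] by (simp add: sum_distrib_left mult_ac)
      also have "\<dots> = (\<Sum>i<r. real (n i) * (3 * real (n i)))"
        by (intro sum.cong refl) (simp add: dim)
      also have "\<dots> = 3 * (?d \<bullet> ?d)"
        by (simp add: scalar_prod_def lessThan_atLeast0 sum_distrib_left mult_ac)
      finally show "?d \<bullet> (symmetrised A *\<^sub>v ?d) = 3 * (?d \<bullet> ?d)" .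
    qed
  qed
qed

section \<open>A common convergence criterion for both families of weights\<close>

lemma N1_weight_positive_definite_iff:
  assumes R: "max_rayleigh r (symmetrised A) 3" and x: "0 < x" "x < 1" "n \<ge> 1"
    and A: "A \<in> carrier_mat r r"
  shows "positive_definite (N1_weight A x n) \<longleftrightarrow> 3 * z_c x n < 1 - z_v x n"
  unfolding N1_weight_def
  using positive_definite_weight_iff[OF R z_c_nonneg[OF x], of "1 / real n" "1 - z_v x n"] A x(3)
  by (simp add: mult.commute)

lemma z_V_eq: "z_V x n = z_v x n + z_c x n"
  unfolding z_V_def z_v_def z_c_def by simp

lemma z_H_eq: "z_H x n = z_c x n"
  unfolding z_H_def z_c_def ..

text \<open>The N = 2 vector multiplet contains one chiral letter, so eigenvalue 2 of the graph and
  this one add up to the 3 of the orbifolds.\<close>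

lemma N2_weight_positive_definite_iff:
  assumes B: "affine_ADE B" and x: "0 < x" "x < 1" "n \<ge> 1"
  shows "positive_definite (N2_weight B x n) \<longleftrightarrow> 3 * z_c x n < 1 - z_v x n"
  unfolding N2_weight_def z_H_eq
  using positive_definite_weight_iff[OF affine_ADE_max_rayleigh[OF B] z_c_nonneg[OF x],
      of "1 / real n" "1 - z_V x n"] x(3)
  by (auto simp: z_V_eq)

theorem mainTheorem2:
  fixes \<Gamma> :: "complex mat set"
    and r :: nat
    and \<chi> :: "nat \<Rightarrow> complex mat \<Rightarrow> complex"
    and A :: "nat mat"
  assumes "subgroup \<Gamma> SU3" and "finite \<Gamma>"
    and "bij_betw \<chi> {..<r} (irreducible_characters (SU3\<lparr>carrier := \<Gamma>\<rparr>))"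
    and "quiver_adjacency \<Gamma> r \<chi> A"
  shows "lambda_max (symmetrised A) = 3
    \<and> (\<exists>!x. is_Hagedorn_point (N1_weight A) x)
    \<and> (\<forall>x. is_Hagedorn_point (N1_weight A) x \<longleftrightarrow>
           0 < x \<and> x < 1 \<and> 1 - z_v x 1 = lambda_max (symmetrised A) * z_c x 1)
    \<and> (\<exists>!T. is_Hagedorn_temperature (N1_weight A) T)
    \<and> (\<forall>B. affine_ADE B \<longrightarrow>
          (\<forall>x. is_Hagedorn_point (N2_weight B) x \<longleftrightarrow>
               0 < x \<and> x < 1 \<and> 1 - z_V x 1 = 2 * z_H x 1)
        \<and> (\<forall>T. is_Hagedorn_temperature (N1_weight A) T \<longleftrightarrow>
               is_Hagedorn_temperature (N2_weight B) T))"
proof -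
  note R = quiver_max_rayleigh(1)[OF assms]
  have A: "A \<in> carrier_mat r r" using assms(4) unfolding quiver_adjacency_def by simp
  note pd1 = N1_weight_positive_definite_iff[OF R _ _ _ A]
  have l: "lambda_max (symmetrised A) = 3" by (rule lambda_max_eq[OF R])
  \<comment> \<open>Each clause reduces to equality with \<open>x_Hag\<close> or with -1 / ln x_Hag;
    these constants involve neither \<Gamma> nor the affine diagram, so the temperatures
    agree.\<close>
  have h1: "is_Hagedorn_point (N1_weight A) x \<longleftrightarrow> x = x_Hag" for x
    by (rule is_Hagedorn_point_iff[OF pd1])
  have t1: "is_Hagedorn_temperature (N1_weight A) T \<longleftrightarrow> T = - 1 / ln x_Hag" for T
    by (rule is_Hagedorn_temperature_iff[OF pd1])
  have h2: "is_Hagedorn_point (N2_weight B) x \<longleftrightarrow> x = x_Hag"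
    if "affine_ADE B" for B x
    by (rule is_Hagedorn_point_iff[OF N2_weight_positive_definite_iff[OF that]])
  have t2: "is_Hagedorn_temperature (N2_weight B) T \<longleftrightarrow> T = - 1 / ln x_Hag"
    if "affine_ADE B" for B T
    by (rule is_Hagedorn_temperature_iff[OF N2_weight_positive_definite_iff[OF that]])
  have eq: "0 < x \<and> x < 1 \<and> 1 - z_v x 1 = 3 * z_c x 1 \<longleftrightarrow> x = x_Hag" for x
    using N4_letter_equation_iff x_Hag_bounds by blast
  have eq2: "1 - z_V x 1 = 2 * z_H x 1 \<longleftrightarrow> 1 - z_v x 1 = 3 * z_c x 1" for x
    unfolding z_V_eq z_H_eq by auto
  show ?thesis
    unfolding l eq2 eq h1 t1 using h2 t2 by auto
qed

end
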